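(* Let $c, d$ be non-negative integers. Let $M$ be a lattice and let $P \subseteq M_{\mathbb{R}}$ be an $n$-dimensional lattice polytope having at most $c+n+1$ vertices and degree $\deg(P) \leq d$. If $$n \geq c(2d+1) + 4d - 1,$$ then $P$ is a lattice pyramid over an $(n-1)$-dimensional lattice polytope.
   Context: A lattice $M$ is a free abelian group of finite rank, and $M_{\mathbb{R}} = M \otimes_{\mathbb{Z}} \mathbb{R}$. A lattice polytope $P \subseteq M_{\mathbb{R}}$ is a polytope all of whose vertices lie in $M$. All lattice notions for $P$ are taken with respect to the affine lattice $\operatorname{aff}(P) \cap M$. For an $n$-dimensional lattice polytope $P$ one has $$\sum_{k \geq 0} |kP \cap M|\, t^k = \frac{h^*_0 + h^*_1 t + \cdots + h^*_n t^n}{(1-t)^{n+1}}$$ with non-negative integers $h^*_i$ (for $k=0$ the number of lattice points is $1$). The numerator is the $h^*$-polynomial of $P$, and the degree $\deg(P)$ of $P$ is the maximal $i$ with $h^*_i \neq 0$. Two lattice polytopes $P \subseteq M_{\mathbb{R}}$ and $P' \subseteq M'_{\mathbb{R}}$ are isomorphic if there is an affine lattice isomorphism $\operatorname{aff}(P)\cap M \cong \operatorname{aff}(P')\cap M'$ mapping the vertices of $P$ onto the vertices of $P'$. For a lattice polytope $B \subseteq \mathbb{R}^k$ with respect to $\mathbb{Z}^k$, the ($1$-fold) standard pyramid over $B$ is $\operatorname{conv}(\{0\} \cup (B \times \{1\})) \subseteq \mathbb{R}^{k+1}$, a lattice polytope with respect to $\mathbb{Z}^{k+1}$; the $l$-fold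 standard pyramid is obtained by iterating this $l$ times, and the $0$-fold standard pyramid over $B$ is $B$ itself. For lattice polytopes $Q \subseteq P$, we say that $P$ is a lattice pyramid over $Q$ if $P$ is isomorphic to the $(\dim(P)-\dim(Q))$-fold standard pyramid over some lattice polytope $B$ by an isomorphism mapping $Q$ onto the copy of $B$ in this standard pyramid. Convention: the empty set counts as a lattice polytope of dimension $-1$, and a single lattice point is a lattice pyramid over it. *)

theory Defs
  imports
    "HOL-Analysis.Analysis"
    "HOL-Analysis.Finite_Function_Topology"
    "HOL-Computational_Algebra.Polynomial_FPS"
begin

section \<open>Lattices and lattice polytopes\<close>

text \<open>
  A lattice is realised as the set of integer combinations of a finite linearly independent
  subset of a real vector space. As the lattice basis is independent over the reals,
  \<open>M\<^sub>\<real> = M \<otimes> \<real>\<close> is \<open>span M\<close>. The lattice need not span the ambient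
  type, so every finite rank occurs, including rank 0.
\<close>

definition z_lattice :: "'a::real_vector set \<Rightarrow> bool" where
  "z_lattice M \<longleftrightarrow>
     (\<exists>B. finite B \<and> independent B \<and> M = range (\<lambda>z. \<Sum>b\<in>B. real_of_int (z b) *\<^sub>R b))"

definition vertices :: "'a::real_vector set \<Rightarrow> 'a set" where
  "vertices P = {v. v extreme_point_of P}"

definition lattice_polytope :: "'a::real_vector set \<Rightarrow> 'a set \<Rightarrow> bool" where
  "lattice_polytope M P \<longleftrightarrow> polytope P \<and> P \<subseteq> span M \<and> vertices P \<subseteq> M"

section \<open>The h*-polynomial and the degree\<close>

definition ehrhart_series :: "'a::real_vector set \<Rightarrow> 'a set \<Rightarrow> int fps" where
  "ehrhart_series M P =
     Abs_fps (\<lambda>k. if k = 0 then 1 else int (card ((*\<^sub>R) (real k) ` P \<inter> M)))"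

text \<open>The defining identity is stated with the denominator cleared.\<close>

definition hstar_poly :: "'a::euclidean_space set \<Rightarrow> 'a set \<Rightarrow> int poly" where
  "hstar_poly M P =
     (THE h. fps_of_poly h = ehrhart_series M P * (1 - fps_X) ^ nat (aff_dim P + 1))"

definition polytope_degree :: "'a::euclidean_space set \<Rightarrow> 'a set \<Rightarrow> nat" where
  "polytope_degree M P = degree (hstar_poly M P)"

section \<open>Isomorphisms of lattice polytopes\<close>

definition affine_map_on :: "'a::real_vector set \<Rightarrow> ('a \<Rightarrow> 'b::real_vector) \<Rightarrow> bool" where
  "affine_map_on A f \<longleftrightarrow>
     (\<forall>x\<in>A. \<forall>y\<in>A. \<forall>u. f ((1 - u) *\<^sub>R x + u *\<^sub>R y) = (1 - u) *\<^sub>R f x + u *\<^sub>R f y)"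

text \<open>
  As the lattice points of \<open>aff(P)\<close> span it affinely, an affine isomorphism
  \<open>aff(P) \<inter> M \<cong> aff(P') \<inter> M'\<close> of affine lattices has exactly one extension to a
  real-affine map on \<open>aff(P)\<close>. The map \<open>\<phi>\<close> below is this extension, so that it can be
  applied to polytopes contained in \<open>P\<close>; its values outside \<open>aff(P)\<close> are irrelevant.
\<close>

definition lattice_polytope_iso ::
  "'a::real_vector set \<Rightarrow> 'a set \<Rightarrow> 'b::real_vector set \<Rightarrow> 'b set \<Rightarrow> ('a \<Rightarrow> 'b) \<Rightarrow> bool" where
  "lattice_polytope_iso M P M' P' \<phi> \<longleftrightarrow>
     affine_map_on (affine hull P) \<phi> \<and>
     bij_betw \<phi> (affine hull P \<inter> M) (affine hull P' \<inter> M') \<and>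
     \<phi> ` vertices P = vertices P'"

section \<open>Standard pyramids\<close>

text \<open>
  All spaces \<open>\<real>\<^sup>k\<close> live inside the space of finitely supported real sequences, \<open>\<real>\<^sup>k\<close>
  being the sequences supported in \<open>{..<k}\<close>. The inclusion of \<open>\<real>\<^sup>k\<close> into
  \<open>\<real>\<^sup>k\<^sup>+\<^sup>1\<close> is thus \<open>x \<mapsto> (x, 0)\<close>.
\<close>

definition int_lattice :: "nat \<Rightarrow> (nat \<Rightarrow>\<^sub>0 real) set" where
  "int_lattice k =
     {x. Poly_Mapping.keys x \<subseteq> {..<k} \<and> (\<forall>i. Poly_Mapping.lookup x i \<in> \<int>)}"

lemma z_lattice_int_lattice: "z_lattice (int_lattice k)"
proof -
  let ?e = "\<lambda>i. Poly_Mapping.single i (1::real)"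
  let ?B = "?e ` {..<k}"
  have inj: "inj_on ?e A" for A
    by (auto simp: inj_on_def poly_mapping_eq_iff lookup_single fun_eq_iff when_def)
  have scale: "Poly_Mapping.lookup (r *\<^sub>R x) i = r * Poly_Mapping.lookup x i"
    for r i and x :: "nat \<Rightarrow>\<^sub>0 real"
  proof -
    have "finite {i. r * Poly_Mapping.lookup x i \<noteq> 0}"
      by (rule finite_subset[OF _ finite_keys[of x]]) (auto simp: in_keys_iff)
    then show ?thesis by (simp add: scaleR_poly_mapping_def Abs_poly_mapping_inverse)
  qed
  have look: "Poly_Mapping.lookup (\<Sum>b\<in>?B. u b *\<^sub>R b) i = (if i < k then u (?e i) else 0)" for u i
  proof -
    have "Poly_Mapping.lookup (\<Sum>b\<in>?B. u b *\<^sub>R b) i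
        = (\<Sum>j<k. u (?e j) * (if j = i then 1 else 0))"
      by (simp add: sum.reindex[OF inj] lookup_sum scale lookup_single when_def)
    also have "\<dots> = (if i < k then u (?e i) else 0)" by (simp add: if_distrib cong: if_cong)
    finally show ?thesis .
  qed
  have "independent ?B"
  proof
    assume "dependent ?B"
    then obtain u v where "v \<in> ?B" "u v \<noteq> 0" "(\<Sum>b\<in>?B. u b *\<^sub>R b) = 0"
      by (auto simp: dependent_finite)
    then show False
    proof -
      obtain i where i: "i < k" "v = ?e i" using \<open>v \<in> ?B\<close> by blast
      have "Poly_Mapping.lookup (\<Sum>b\<in>?B. u b *\<^sub>R b) i = u v"
        using look[of u i] i by simp
      then show False using \<open>u v \<noteq> 0\<close> \<open>(\<Sum>b\<in>?B. u b *\<^sub>R b) = 0\<close> by simp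
    qed
  qed
  moreover have "int_lattice k = range (\<lambda>z. \<Sum>b\<in>?B. real_of_int (z b) *\<^sub>R b)" (is "_ = ?R")
  proof (intro equalityI subsetI)
    fix x assume x: "x \<in> int_lattice k"
    define z where "z b = \<lfloor>Poly_Mapping.lookup x (inv_into UNIV ?e b)\<rfloor>" for b
    have "x = (\<Sum>b\<in>?B. real_of_int (z b) *\<^sub>R b)"
    proof (rule poly_mapping_eqI)
      fix i
      have "real_of_int (z (?e i)) = Poly_Mapping.lookup x i"
        using x inv_into_f_f[OF inj, of i UNIV] by (simp add: z_def int_lattice_def)
      moreover have "Poly_Mapping.lookup x i = 0" if "\<not> i < k"
        using x that by (auto simp: int_lattice_def in_keys_iff)
      ultimately show "Poly_Mapping.lookup x i
          = Poly_Mapping.lookup (\<Sum>b\<in>?B. real_of_int (z b) *\<^sub>R b) i"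
        using look[of "\<lambda>b. real_of_int (z b)" i] by auto
    qed
    then show "x \<in> ?R" by blast
  next
    fix x assume "x \<in> ?R"
    then obtain z where "x = (\<Sum>b\<in>?B. real_of_int (z b) *\<^sub>R b)" by blast
    then have "Poly_Mapping.lookup x i = (if i < k then real_of_int (z (?e i)) else 0)" for i
      using look[of "\<lambda>b. real_of_int (z b)" i] by simp
    then show "x \<in> int_lattice k"
      by (auto simp: int_lattice_def in_keys_iff split: if_splits)
  qed
  ultimately show ?thesis unfolding z_lattice_def by (intro exI[of _ ?B]) simp
qed

text \<open>For \<open>S \<subseteq> \<real>\<^sup>k\<close>, this is \<open>S \<times> {1} \<subseteq> \<real>\<^sup>k\<^sup>+\<^sup>1\<close>.\<close>

definition lift1 :: "nat \<Rightarrow> (nat \<Rightarrow>\<^sub>0 real) set \<Rightarrow> (nat \<Rightarrow>\<^sub>0 real) set" where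
  "lift1 k S = (\<lambda>x. x + Poly_Mapping.single k 1) ` S"

text \<open>
  \<open>std_pyramid k l B\<close> is the \<open>l\<close>-fold standard pyramid in \<open>\<real>\<^sup>k\<^sup>+\<^sup>l\<close> over
  \<open>B \<subseteq> \<real>\<^sup>k\<close>, and \<open>std_base k l B\<close> is the copy \<open>B \<times> {(1, \<dots>, 1)}\<close> of
  \<open>B\<close> in it.
\<close>

fun std_pyramid :: "nat \<Rightarrow> nat \<Rightarrow> (nat \<Rightarrow>\<^sub>0 real) set \<Rightarrow> (nat \<Rightarrow>\<^sub>0 real) set" where
  "std_pyramid k 0 B = B"
| "std_pyramid k (Suc l) B = convex hull ({0} \<union> lift1 (k + l) (std_pyramid k l B))"

fun std_base :: "nat \<Rightarrow> nat \<Rightarrow> (nat \<Rightarrow>\<^sub>0 real) set \<Rightarrow> (nat \<Rightarrow>\<^sub>0 real) set" where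
  "std_base k 0 B = B"
| "std_base k (Suc l) B = lift1 (k + l) (std_base k l B)"

text \<open>
  The empty set is a lattice polytope here, with \<open>aff_dim {} = -1\<close>; \<open>B\<close> and \<open>Q\<close> may
  be empty, and the pyramid over the empty set is a lattice point.
\<close>

definition lattice_pyramid_over :: "'a::euclidean_space set \<Rightarrow> 'a set \<Rightarrow> 'a set \<Rightarrow> bool" where
  "lattice_pyramid_over M P Q \<longleftrightarrow>
     lattice_polytope M P \<and> lattice_polytope M Q \<and> Q \<subseteq> P \<and>
     (let l = nat (aff_dim P - aff_dim Q) in
       \<exists>k B \<phi>. lattice_polytope (int_lattice k) B \<and>
         lattice_polytope_iso M P (int_lattice (k + l)) (std_pyramid k l B) \<phi> \<and>
         \<phi> ` Q = std_base k l B)"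

lemma lattice_pyramid_over_point:
  assumes "x \<in> M"
  shows "lattice_pyramid_over M {x} {}"
proof -
  have v: "vertices {y} = {y}" for y :: "'b::real_vector"
    by (auto simp: vertices_def extreme_point_of_def)
  have "x \<in> span M" using assms by (rule span_base)
  then have P: "lattice_polytope M {x}"
    using assms by (auto simp: lattice_polytope_def v polytope_sing)
  have E: "lattice_polytope N {}" for N :: "'b::real_vector set"
    by (auto simp: lattice_polytope_def vertices_def extreme_point_of_def polytope_def)
  have "lattice_polytope_iso M {x} (int_lattice (0 + 1)) (std_pyramid 0 1 {}) (\<lambda>_. 0)"
    using assms
    by (auto simp: lattice_polytope_iso_def affine_map_on_def lift1_def v bij_betw_def
        int_lattice_def hull_same[of affine, OF affine_sing])
  moreover have "(\<lambda>_. 0) ` {} = std_base 0 1 {}"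
    by (auto simp: lift1_def)
  ultimately show ?thesis
    unfolding lattice_pyramid_over_def Let_def using P E[of M] E[of "int_lattice 0"]
    by (auto intro!: exI[of _ 0] exI[of _ "{}"])
qed

end

(*
  Put the vertices of P at height 1. For generic weights on the vertices, the optimal bases of
  the resulting linear programs tile the cone over P by simplicial cones, and a generic point q
  makes this tiling a partition into half-open cones. The h*-polynomial counts the lattice points
  in the half-open fundamental boxes by height. Its coefficients are therefore sums without
  cancellation, and a lattice point x in the interior of the cone gives a box point congruent to
  -x of height at least n + 1 - h(x); so every interior lattice point has height at least
  n + 1 - d.

  Fix a simplex S spanned by n + 1 vertices. Applied to complements of the points in its closed-open
  fundamental box, the bound shows that every element of this finite group has support of size at
  most 2d. As each coordinate that occurs is non-zero on at least half of the group, fewer than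
  4d coordinates occur if d > 0, and none if d = 0. For a vertex v outside S, the two sides of the
  circuit of v and S give interior lattice points, whose heights show that v has at most 2d + 1
  non-zero coordinates (and that there is no such v if d = 0). With at most c vertices outside S,
  some vertex of S is involved in none of this, and it is the apex of a lattice pyramid.
*)

theory Submission
  imports Defs
begin

section \<open>Coordinates with respect to an independent set\<close>

text \<open>Extending \<open>B\<close> to a basis makes the coordinates linear on the whole space.\<close>

definition crd :: "'b::real_vector set \<Rightarrow> 'b \<Rightarrow> 'b \<Rightarrow> real" where
  "crd B x b = real_vector.representation (real_vector.extend_basis B) x b"

context
  fixes B :: "'b::real_vector set"
  assumes B: "independent B"
begin

lemma linear_crd: "linear (\<lambda>x. crd B x b)"
  unfolding crd_def
  using real_vector.linear_representation[of "real_vector.extend_basis B" b]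
    real_vector.independent_extend_basis[OF B] real_vector.span_extend_basis[OF B]
  by (simp add: linear_def scaleR_conv_of_real[abs_def] module_hom_def)
  
lemma crd_basis: "b' \<in> B \<Longrightarrow> crd B b' b = (if b = b' then 1 else 0)"
  using real_vector.representation_basis[OF real_vector.independent_extend_basis[OF B], of b']
    real_vector.extend_basis_superset[OF B]
  by (auto simp: crd_def)

lemma crd_sum:
  assumes "finite B" "b \<in> B"
  shows "crd B (\<Sum>v\<in>B. c v *\<^sub>R v) b = c b"
proof -
  have "crd B (\<Sum>v\<in>B. c v *\<^sub>R v) b = (\<Sum>v\<in>B. c v * crd B v b)"
    by (simp add: linear_sum[OF linear_crd] linear_scale[OF linear_crd])
  also have "\<dots> = (\<Sum>v\<in>B. if v = b then c v else 0)"
    by (intro sum.cong) (auto simp: crd_basis)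
  finally show ?thesis using assms by simp
qed

lemma crd_expand:
  assumes "finite B" "x \<in> span B"
  shows "x = (\<Sum>b\<in>B. crd B x b *\<^sub>R b)"
proof -
  obtain c where "x = (\<Sum>b\<in>B. c b *\<^sub>R b)"
    using assms by (auto simp: span_finite)
  then show ?thesis using crd_sum[OF assms(1), of _ c] by (auto intro: sum.cong)
qed

end

lemma crd_add: "independent B \<Longrightarrow> crd B (x + y) b = crd B x b + crd B y b"
  using linear_add[OF linear_crd] .
lemma crd_diff: "independent B \<Longrightarrow> crd B (x - y) b = crd B x b - crd B y b"
  using linear_diff[OF linear_crd] .
lemma crd_scale: "independent B \<Longrightarrow> crd B (r *\<^sub>R x) b = r * crd B x b"
  using linear_scale[OF linear_crd] by simp

lemma crd_neg: "independent B \<Longrightarrow> crd B (- x) b = - crd B x b"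
  using linear_neg[OF linear_crd] .

section \<open>Regular tilings of a cone\<close>

text \<open>By induction on \<open>C\<close>: the new form is made non-zero by raising the weight of
  a point \<open>v0\<close> that occurs in it. Only finitely many increments make a form with
  \<open>v0\<close> vanish, and forms without \<open>v0\<close> keep their value.\<close>

lemma avoid_hyperplanes:
  assumes "finite C" "finite V" "\<And>c. c \<in> C \<Longrightarrow> \<exists>v\<in>V. c v \<noteq> (0::real)"
  shows "\<exists>\<mu>. (\<forall>v. \<mu> v > 0) \<and> (\<forall>c\<in>C. (\<Sum>v\<in>V. c v * \<mu> v) \<noteq> 0)"
  using assms(1,3)
proof (induction C rule: finite_induct)
  case empty
  then show ?case by (intro exI[of _ "\<lambda>_. 1"]) auto
next
  case (insert c C)
  then obtain \<mu> where mu: "\<And>v. \<mu> v > 0" "\<And>c. c \<in> C \<Longrightarrow> (\<Sum>v\<in>V. c v * \<mu> v) \<noteq> 0"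
    by auto
  obtain v0 where v0: "v0 \<in> V" "c v0 \<noteq> 0" using insert.prems by auto
  \<comment> \<open>A form with \<open>c' v0 = 0\<close> contributes 0, the value of a division by
    zero; this is harmless because only \<open>t > 0\<close> is considered.\<close>
  define bad where "bad = (\<lambda>c'. - (\<Sum>v\<in>V. c' v * \<mu> v) / c' v0) ` insert c C"
  have "infinite ({0<..} - bad)"
    using insert.hyps by (auto simp: bad_def infinite_Ioi)
  then obtain t where t: "t > 0" "t \<notin> bad"
    by (metis DiffE all_not_in_conv finite.emptyI greaterThan_iff)
  define \<mu>' where "\<mu>' v = \<mu> v + (if v = v0 then t else 0)" for v
  have s: "(\<Sum>v\<in>V. c' v * \<mu>' v) = (\<Sum>v\<in>V. c' v * \<mu> v) + c' v0 * t" for c'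
  proof -
    have "(\<Sum>v\<in>V. c' v * \<mu>' v) = (\<Sum>v\<in>V. c' v * \<mu> v + (if v = v0 then c' v0 * t else 0))"
      by (intro sum.cong) (auto simp: \<mu>'_def distrib_left)
    then show ?thesis using assms(2) v0 by (simp add: sum.distrib)
  qed
  show ?case
  proof (intro exI conjI allI ballI)
    show "\<mu>' v > 0" for v using mu(1)[of v] t(1) by (auto simp: \<mu>'_def)
    fix c' assume c': "c' \<in> insert c C"
    show "(\<Sum>v\<in>V. c' v * \<mu>' v) \<noteq> 0"
    proof (cases "c' v0 = 0")
      case True
      then show ?thesis using c' v0 mu(2) by (auto simp: s)
    next
      case False
      have "t \<noteq> - (\<Sum>v\<in>V. c' v * \<mu> v) / c' v0" using t c' by (auto simp: bad_def)
      with False show ?thesis unfolding s by (simp add: field_simps)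
    qed
  qed
qed

text \<open>A homogenised point configuration. Height 1 on all of \<open>V\<close> makes the cone
  over \<open>V\<close> pointed and turns heights into sums of coefficients.\<close>

locale height_config =
  fixes V :: "'b::real_vector set" and h :: "'b \<Rightarrow> real"
  assumes finV: "finite V" and lin_h: "linear h" and h_one: "\<And>v. v \<in> V \<Longrightarrow> h v = 1"
begin

definition bases :: "'b set set" where
  "bases = {B. B \<subseteq> V \<and> independent B \<and> span B = span V}"

definition pos_cone :: "'b set" where
  "pos_cone = {\<Sum>v\<in>V. c v *\<^sub>R v |c. \<forall>v\<in>V. c v \<ge> 0}"

lemma basesD:
  assumes "B \<in> bases"
  shows "B \<subseteq> V" "independent B" "span B = span V" "finite B"
  using assms finV finite_subset by (auto simp: bases_def)

lemma finite_bases: "finite bases"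
  by (rule finite_subset[of _ "Pow V"]) (auto simp: bases_def finV)

lemma card_bases: "B \<in> bases \<Longrightarrow> card B = dim V"
  by (metis basesD(2,3) dim_eq_card)

lemma expand: "B \<in> bases \<Longrightarrow> x \<in> span V \<Longrightarrow> x = (\<Sum>b\<in>B. crd B x b *\<^sub>R b)"
  using crd_expand basesD by metis

lemma h_sum: "S \<subseteq> V \<Longrightarrow> h (\<Sum>v\<in>S. c v *\<^sub>R v) = (\<Sum>v\<in>S. c v)"
  using h_one by (auto simp: linear_sum[OF lin_h] linear_scale[OF lin_h] intro!: sum.cong)

lemma h_expand: "B \<in> bases \<Longrightarrow> x \<in> span V \<Longrightarrow> h x = (\<Sum>b\<in>B. crd B x b)"
  using h_sum[OF basesD(1)] expand by metis

lemma comb_in_span: "S \<subseteq> V \<Longrightarrow> (\<Sum>v\<in>S. c v *\<^sub>R v) \<in> span V"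
  by (intro span_sum span_scale span_base) auto

lemma cone_span: "pos_cone \<subseteq> span V"
  unfolding pos_cone_def using comb_in_span by auto

lemma comb_in_cone:
  assumes "S \<subseteq> V" "\<And>v. v \<in> S \<Longrightarrow> c v \<ge> 0"
  shows "(\<Sum>v\<in>S. c v *\<^sub>R v) \<in> pos_cone"
proof -
  have "(\<Sum>v\<in>S. c v *\<^sub>R v) = (\<Sum>v\<in>V. (if v \<in> S then c v else 0) *\<^sub>R v)"
    using assms(1) finV by (intro sum.mono_neutral_cong_left) auto
  then show ?thesis using assms(2) unfolding pos_cone_def by force
qed

lemma cone_add:
  assumes "x \<in> pos_cone" "y \<in> pos_cone"
  shows "x + y \<in> pos_cone"
proof -
  obtain a b where "\<forall>v\<in>V. a v \<ge> 0" "x = (\<Sum>v\<in>V. a v *\<^sub>R v)" "\<forall>v\<in>V. b v \<ge> 0" "y = (\<Sum>v\<in>V. b v *\<^sub>R v)"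
    using assms unfolding pos_cone_def by auto
  then show ?thesis
    using comb_in_cone[of V "\<lambda>v. a v + b v"] by (simp add: scaleR_add_left sum.distrib)
qed

lemma cone_scale:
  assumes "x \<in> pos_cone" "r \<ge> 0"
  shows "r *\<^sub>R x \<in> pos_cone"
proof -
  obtain a where "\<forall>v\<in>V. a v \<ge> 0" "x = (\<Sum>v\<in>V. a v *\<^sub>R v)"
    using assms unfolding pos_cone_def by auto
  then show ?thesis
    using assms comb_in_cone[of V "\<lambda>v. r * a v"] by (simp add: scaleR_sum_right)
qed

lemma in_cone_crd:
  assumes "B \<in> bases" "x \<in> span V" "\<And>b. b \<in> B \<Longrightarrow> crd B x b \<ge> 0"
  shows "x \<in> pos_cone"
  using comb_in_cone[OF basesD(1)[OF assms(1)], of "crd B x"] expand[OF assms(1,2)] assms(3) by auto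

lemma h_cone_nonneg: "x \<in> pos_cone \<Longrightarrow> h x \<ge> 0"
  unfolding pos_cone_def by (auto simp: h_sum intro!: sum_nonneg)

lemma basis_extend:
  assumes "T \<subseteq> V" "independent T"
  obtains B where "T \<subseteq> B" "B \<in> bases"
proof -
  obtain B where B: "T \<subseteq> B" "B \<subseteq> V" "independent B" "V \<subseteq> span B"
    using maximal_independent_subset_extend[OF assms] .
  then have "span B = span V"
    by (meson span_minimal span_mono subset_antisym subspace_span)
  with B that show thesis by (auto simp: bases_def)
qed

text \<open>
  Along a linear dependency of the support, chosen with the sign that does not increase the
  cost, one coefficient can be moved to zero. A dependency has coefficients of both signs
  because all points have height 1.
\<close>

lemma weighted_caratheodory:
  assumes "T \<subseteq> V" "\<And>v. v \<in> T \<Longrightarrow> c v \<ge> 0"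
  shows "\<exists>B\<in>bases. (\<forall>b\<in>B. crd B (\<Sum>v\<in>T. c v *\<^sub>R v) b \<ge> 0) \<and>
    (\<Sum>b\<in>B. crd B (\<Sum>v\<in>T. c v *\<^sub>R v) b * w b) \<le> (\<Sum>v\<in>T. c v * w v)"
  using assms
proof (induction "card T" arbitrary: T c rule: less_induct)
  case less
  have finT: "finite T" using less.prems finV finite_subset by auto
  show ?case
  proof (cases "independent T")
    case True
    then obtain B where B: "T \<subseteq> B" "B \<in> bases" using basis_extend less.prems by blast
    note BD = basesD[OF B(2)]
    define c' where "c' v = (if v \<in> T then c v else 0)" for v
    have eq: "(\<Sum>v\<in>T. c v *\<^sub>R v) = (\<Sum>v\<in>B. c' v *\<^sub>R v)"
      using B BD by (intro sum.mono_neutral_cong_left) (auto simp: c'_def)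
    have cr: "crd B (\<Sum>v\<in>T. c v *\<^sub>R v) b = c' b" if "b \<in> B" for b
      unfolding eq using crd_sum[OF BD(2,4) that] .
    have "(\<Sum>b\<in>B. c' b * w b) = (\<Sum>v\<in>T. c v * w v)"
      using B BD by (intro sum.mono_neutral_cong_right) (auto simp: c'_def)
    moreover have "(\<Sum>b\<in>B. crd B (\<Sum>v\<in>T. c v *\<^sub>R v) b * w b) = (\<Sum>b\<in>B. c' b * w b)"
      using cr by (intro sum.cong) auto
    ultimately show ?thesis using B cr less.prems by (intro bexI[of _ B]) (auto simp: c'_def)
  next
    case False
    then obtain u v1 where u: "v1 \<in> T" "u v1 \<noteq> 0" "(\<Sum>v\<in>T. u v *\<^sub>R v) = 0"
      using finT by (auto simp: dependent_finite)
    define \<sigma> :: real where "\<sigma> = (if (\<Sum>v\<in>T. u v * w v) \<ge> 0 then 1 else -1)"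
    define a where "a v = \<sigma> * u v" for v
    have a0: "(\<Sum>v\<in>T. a v *\<^sub>R v) = 0"
      using u(3) by (simp add: a_def flip: scaleR_scaleR scaleR_sum_right)
    have aw: "(\<Sum>v\<in>T. a v * w v) \<ge> 0"
      by (simp add: a_def \<sigma>_def mult.assoc flip: sum_distrib_left)
    have "(\<Sum>v\<in>T. a v) = 0" using h_sum[OF less.prems(1), of a] a0 linear_0[OF lin_h] by simp
    moreover have "a v1 \<noteq> 0" using u by (simp add: a_def \<sigma>_def)
    ultimately have "\<exists>v\<in>T. a v > 0"
      using u(1) finT sum_nonneg_eq_0_iff[of T "\<lambda>v. - a v"]
      by (force simp: sum_negf not_less)
    then have ne: "{v\<in>T. a v > 0} \<noteq> {}" by auto
    define \<epsilon> where "\<epsilon> = Min ((\<lambda>v. c v / a v) ` {v\<in>T. a v > 0})"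
    have fin: "finite ((\<lambda>v. c v / a v) ` {v\<in>T. a v > 0})" using finT by auto
    have "\<epsilon> \<in> (\<lambda>v. c v / a v) ` {v\<in>T. a v > 0}"
      unfolding \<epsilon>_def using ne fin by (intro Min_in) auto
    then obtain v0 where v0: "v0 \<in> T" "a v0 > 0" "\<epsilon> = c v0 / a v0" by auto
    have ele: "\<epsilon> * a v \<le> c v" if "v \<in> T" "a v > 0" for v
    proof -
      have "\<epsilon> \<le> c v / a v" unfolding \<epsilon>_def using fin that by (intro Min_le) auto
      then show ?thesis using that by (simp add: field_simps)
    qed
    have e0: "\<epsilon> \<ge> 0" using v0 less.prems by simp
    define c' where "c' v = c v - \<epsilon> * a v" for v
    have c'0: "c' v0 = 0" using v0 by (simp add: c'_def)
    have c'nn: "c' v \<ge> 0" if "v \<in> T" for v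
    proof (cases "a v > 0")
      case True then show ?thesis using ele that by (simp add: c'_def)
    next
      case False
      then have "\<epsilon> * a v \<le> 0" using e0 by (simp add: mult_nonneg_nonpos)
      then show ?thesis using less.prems(2)[OF that] by (simp add: c'_def)
    qed
    have eq: "(\<Sum>v\<in>T - {v0}. c' v *\<^sub>R v) = (\<Sum>v\<in>T. c v *\<^sub>R v)"
    proof -
      have "(\<Sum>v\<in>T - {v0}. c' v *\<^sub>R v) = (\<Sum>v\<in>T. c' v *\<^sub>R v)"
        using finT v0 c'0 by (simp add: sum.remove)
      also have "\<dots> = (\<Sum>v\<in>T. c v *\<^sub>R v) - \<epsilon> *\<^sub>R (\<Sum>v\<in>T. a v *\<^sub>R v)"
        by (simp add: c'_def scaleR_diff_left sum_subtractf scaleR_sum_right)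
      finally show ?thesis using a0 by simp
    qed
    have cost: "(\<Sum>v\<in>T - {v0}. c' v * w v) \<le> (\<Sum>v\<in>T. c v * w v)"
    proof -
      have "(\<Sum>v\<in>T - {v0}. c' v * w v) = (\<Sum>v\<in>T. c' v * w v)"
        using finT v0 c'0 by (simp add: sum.remove)
      also have "\<dots> = (\<Sum>v\<in>T. c v * w v) - \<epsilon> * (\<Sum>v\<in>T. a v * w v)"
        by (simp add: c'_def left_diff_distrib sum_subtractf sum_distrib_left mult.assoc)
      finally show ?thesis using aw e0 by simp
    qed
    have "card (T - {v0}) < card T" using finT v0 by (meson card_Diff1_less)
    then have "\<exists>B\<in>bases. (\<forall>b\<in>B. crd B (\<Sum>v\<in>T-{v0}. c' v *\<^sub>R v) b \<ge> 0) \<and>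
      (\<Sum>b\<in>B. crd B (\<Sum>v\<in>T-{v0}. c' v *\<^sub>R v) b * w b) \<le> (\<Sum>v\<in>T-{v0}. c' v * w v)"
      using less.hyps[of "T - {v0}" c'] less.prems c'nn by auto
    then show ?thesis unfolding eq using cost by force
  qed
qed

definition generic :: "'b \<Rightarrow> bool" where
  "generic y \<longleftrightarrow> y \<in> span V \<and> (\<forall>B\<in>bases. \<forall>b\<in>B. crd B y b \<noteq> 0)"

text \<open>When every \<open>v\<close> is lifted to \<open>(v, w v)\<close>, no further point lies
  on the hyperplane through the lifted points of a basis.\<close>

definition generic_weight :: "('b \<Rightarrow> real) \<Rightarrow> bool" where
  "generic_weight w \<longleftrightarrow> (\<forall>B\<in>bases. \<forall>v\<in>V - B. (\<Sum>b\<in>B. crd B v b * w b) \<noteq> w v)"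

text \<open>The linear functional that agrees with \<open>w\<close> on \<open>B\<close> stays
  strictly below \<open>w\<close> on the rest of \<open>V\<close>. For generic \<open>w\<close>
  these are the simplices of the regular triangulation induced by \<open>w\<close>; in terms of
  linear programming, the bases with positive reduced costs.\<close>

definition tiles :: "('b \<Rightarrow> real) \<Rightarrow> 'b set set" where
  "tiles w = {B\<in>bases. \<forall>v\<in>V - B. (\<Sum>b\<in>B. crd B v b * w b) < w v}"

text \<open>A pair \<open>(B, v)\<close> with \<open>v\<close> outside \<open>B\<close> gives a
  linear form in \<open>w\<close> whose coefficient at \<open>v\<close> is -1, so each of the
  finitely many forms is non-trivial.\<close>

lemma exists_generic_weight: "\<exists>w. generic_weight w"
proof -
  define cf :: "'b set \<times> 'b \<Rightarrow> 'b \<Rightarrow> real" where "cf = (\<lambda>(B,v) u. (if u \<in> B then crd B v u else 0) - (if u = v then 1 else (0::real)))"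
  define C where "C = cf ` (SIGMA B:bases. V - B)"
  have "finite C" unfolding C_def using finite_bases finV by auto
  moreover have "\<exists>v\<in>V. c v \<noteq> 0" if "c \<in> C" for c
    using that by (force simp: C_def cf_def)
  ultimately obtain w where w: "\<forall>c\<in>C. (\<Sum>v\<in>V. c v * w v) \<noteq> 0"
    using avoid_hyperplanes[of C V] finV by auto
  have "(\<Sum>b\<in>B. crd B v b * w b) \<noteq> w v" if "B \<in> bases" "v \<in> V - B" for B v
  proof -
    have "cf (B,v) \<in> C" using that by (auto simp: C_def)
    then have "(\<Sum>u\<in>V. cf (B,v) u * w u) \<noteq> 0" using w by auto
    moreover have "(\<Sum>u\<in>V. cf (B,v) u * w u) = (\<Sum>u\<in>V. if u \<in> B then crd B v u * w u else 0) - w v"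
      using that finV by (simp add: cf_def left_diff_distrib sum_subtractf if_distrib[of "\<lambda>x. x * _"] cong: if_cong)
    moreover have "(\<Sum>u\<in>V. if u \<in> B then crd B v u * w u else 0) = (\<Sum>b\<in>B. crd B v b * w b)"
      using basesD[OF that(1)] finV by (intro sum.mono_neutral_cong_right) auto
    ultimately show ?thesis by simp
  qed
  then show ?thesis unfolding generic_weight_def by auto
qed

text \<open>Weak duality: the functional that extends \<open>w\<close> linearly from
  \<open>B\<close> gives all representations of \<open>x\<close> the same price, and on
  \<open>S\<close> it never exceeds \<open>w\<close>.\<close>

lemma cost_bound:
  assumes B: "B \<in> bases" and c: "\<And>v. v \<in> S \<Longrightarrow> c v \<ge> 0" "S \<subseteq> V"
    and le: "\<And>v. v \<in> S \<Longrightarrow> (\<Sum>b\<in>B. crd B v b * w b) \<le> w v"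
    and x: "x = (\<Sum>v\<in>S. c v *\<^sub>R v)"
  shows "(\<Sum>b\<in>B. crd B x b * w b) = (\<Sum>v\<in>S. c v * (\<Sum>b\<in>B. crd B v b * w b))"
    "(\<Sum>b\<in>B. crd B x b * w b) \<le> (\<Sum>v\<in>S. c v * w v)"
proof -
  have I: "independent B" using basesD B by auto
  have "crd B x b = (\<Sum>v\<in>S. c v * crd B v b)" for b
    by (simp add: x linear_sum[OF linear_crd[OF I]] linear_scale[OF linear_crd[OF I]])
  then show eq: "(\<Sum>b\<in>B. crd B x b * w b) = (\<Sum>v\<in>S. c v * (\<Sum>b\<in>B. crd B v b * w b))"
    by (simp add: sum_distrib_right sum_distrib_left mult.assoc) (rule sum.swap)
  show "(\<Sum>b\<in>B. crd B x b * w b) \<le> (\<Sum>v\<in>S. c v * w v)"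
    unfolding eq using c le by (intro sum_mono mult_left_mono) auto
qed

lemma weight_tile_le:
  assumes "B \<in> tiles w" "v \<in> V"
  shows "(\<Sum>b\<in>B. crd B v b * w b) \<le> w v"
proof (cases "v \<in> B")
  case True
  have B: "independent B" "finite B" using assms basesD by (auto simp: tiles_def)
  have "(\<Sum>b\<in>B. crd B v b * w b) = (\<Sum>b\<in>B. if b = v then w b else 0)"
    using crd_basis[OF B(1) True] by (intro sum.cong) auto
  then show ?thesis using B True by simp
next
  case False
  then show ?thesis using assms by (auto simp: tiles_def less_imp_le)
qed

text \<open>Suppose that \<open>b0\<close> in \<open>B\<close> is missing from \<open>B'\<close>.
  Pricing the representation of \<open>y\<close> over \<open>B\<close> by the functional of
  \<open>B'\<close> is then strictly cheaper than its cost under \<open>w\<close>, while exchanging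
  the roles of the tiles gives the opposite weak inequality.\<close>

lemma tile_unique:
  assumes B: "B \<in> tiles w" "\<forall>b\<in>B. crd B y b > 0" and B': "B' \<in> tiles w" "\<forall>b\<in>B'. crd B' y b > 0"
    and y: "y \<in> span V"
  shows "B \<subseteq> B'"
proof (rule ccontr)
  assume "\<not> B \<subseteq> B'"
  then obtain b0 where b0: "b0 \<in> B" "b0 \<notin> B'" by auto
  have bs: "B \<in> bases" "B' \<in> bases" using B B' by (auto simp: tiles_def)
  note BD = basesD[OF bs(1)] and BD' = basesD[OF bs(2)]
  have "(\<Sum>b\<in>B'. crd B' y b * w b) = (\<Sum>v\<in>B. crd B y v * (\<Sum>b\<in>B'. crd B' v b * w b))"
    using B BD weight_tile_le[OF B'(1)] expand[OF bs(1) y]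
    by (intro cost_bound(1)[OF bs(2)]) (auto simp: less_imp_le)
  also have "\<dots> < (\<Sum>v\<in>B. crd B y v * w v)"
  proof (rule sum_strict_mono_ex1)
    show "\<forall>v\<in>B. crd B y v * (\<Sum>b\<in>B'. crd B' v b * w b) \<le> crd B y v * w v"
      using B BD weight_tile_le[OF B'(1)] by (intro ballI mult_left_mono) (auto simp: less_imp_le)
    show "\<exists>v\<in>B. crd B y v * (\<Sum>b\<in>B'. crd B' v b * w b) < crd B y v * w v"
      using b0 B BD B' by (intro bexI[of _ b0]) (auto simp: tiles_def)
  qed (rule BD)
  also have "\<dots> \<le> (\<Sum>b\<in>B'. crd B' y b * w b)"
    using B' BD' weight_tile_le[OF B(1)] expand[OF bs(2) y]
    by (intro cost_bound(2)[OF bs(1)]) (auto simp: less_imp_le)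
  finally show False by simp
qed

text \<open>A simplex pivot, started from a cheapest basis in which \<open>y\<close> has
  non-negative coordinates. A point \<open>v\<close> violating the tile condition has negative
  reduced cost because \<open>w\<close> is generic. A little of \<open>v\<close> can then enter the
  representation of \<open>y\<close> at lower cost, and \<open>weighted_caratheodory\<close> returns
  a cheaper basis.\<close>

lemma tile_exists:
  assumes w: "generic_weight w" and y: "generic y" "y \<in> pos_cone"
  shows "\<exists>B\<in>tiles w. \<forall>b\<in>B. crd B y b > 0"
proof -
  have ys: "y \<in> span V" using y by (auto simp: generic_def)
  define F where "F = {B\<in>bases. \<forall>b\<in>B. crd B y b \<ge> 0}"
  define cost where "cost B = (\<Sum>b\<in>B. crd B y b * w b)" for B
  obtain c0 where c0: "\<And>v. v \<in> V \<Longrightarrow> c0 v \<ge> 0" "y = (\<Sum>v\<in>V. c0 v *\<^sub>R v)"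
    using y(2) by (auto simp: pos_cone_def)
  have "F \<noteq> {}" using weighted_caratheodory[OF order.refl, of c0 w] c0 unfolding F_def by auto
  moreover have finF: "finite F" using finite_bases by (auto simp: F_def)
  ultimately obtain B where B: "B \<in> F" "\<And>B'. B' \<in> F \<Longrightarrow> cost B \<le> cost B'"
    using arg_min_if_finite[of F cost] by (metis not_less)
  have bs: "B \<in> bases" using B by (auto simp: F_def)
  note BD = basesD[OF bs]
  have pos: "crd B y b > 0" if "b \<in> B" for b
    using that B(1) y(1) bs unfolding F_def generic_def by (metis (mono_tags, lifting) mem_Collect_eq order_le_less)
  have "(\<Sum>b\<in>B. crd B v b * w b) < w v" if v: "v \<in> V - B" for v
  proof (rule ccontr)
    assume "\<not> ?thesis"
    moreover have "(\<Sum>b\<in>B. crd B v b * w b) \<noteq> w v"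
      using w bs v by (auto simp: generic_weight_def)
    ultimately have gt: "(\<Sum>b\<in>B. crd B v b * w b) > w v" by simp
    have "\<forall>\<^sub>F \<epsilon> in at_right 0. \<forall>b\<in>B. crd B y b - \<epsilon> * crd B v b > 0"
    proof (intro eventually_ball_finite BD ballI)
      fix b assume b: "b \<in> B"
      have "((\<lambda>\<epsilon>. crd B y b - \<epsilon> * crd B v b) \<longlongrightarrow> crd B y b - 0 * crd B v b) (at_right 0)"
        by (intro tendsto_intros)
      then show "\<forall>\<^sub>F \<epsilon> in at_right 0. crd B y b - \<epsilon> * crd B v b > 0"
        using pos[OF b] by (intro order_tendstoD(1)[where y = "crd B y b"]) auto
    qed
    then have "\<forall>\<^sub>F \<epsilon> in at_right (0::real). \<epsilon> > 0 \<and> (\<forall>b\<in>B. crd B y b - \<epsilon> * crd B v b > 0)"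
      by (intro eventually_conj eventually_at_right_less)
    then obtain \<epsilon> where e: "\<epsilon> > 0" "\<And>b. b \<in> B \<Longrightarrow> crd B y b - \<epsilon> * crd B v b > 0"
      using eventually_happens'[OF trivial_limit_at_right_real] by (metis (no_types, lifting))
    define c where "c u = (if u = v then \<epsilon> else crd B y u - \<epsilon> * crd B v u)" for u
    have vB: "v \<notin> B" "v \<in> V" using v by auto
    \<comment> \<open>Kept general in \<open>g\<close>, since it evaluates both the vector sum and
      the cost of the new representation.\<close>
    have cB: "(\<Sum>u\<in>insert v B. g (c u) u) = g \<epsilon> v + (\<Sum>u\<in>B. g (crd B y u - \<epsilon> * crd B v u) u)"
      for g :: "real \<Rightarrow> 'b \<Rightarrow> 'c::comm_monoid_add"
    proof -
      have "(\<Sum>u\<in>B. g (c u) u) = (\<Sum>u\<in>B. g (crd B y u - \<epsilon> * crd B v u) u)"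
        using vB by (intro sum.cong) (auto simp: c_def)
      then show ?thesis using vB BD by (simp add: c_def)
    qed
    have cy: "(\<Sum>u\<in>insert v B. c u *\<^sub>R u) = y"
    proof -
      have "(\<Sum>u\<in>B. (crd B y u - \<epsilon> * crd B v u) *\<^sub>R u)
          = (\<Sum>u\<in>B. crd B y u *\<^sub>R u) - \<epsilon> *\<^sub>R (\<Sum>u\<in>B. crd B v u *\<^sub>R u)"
        by (simp add: scaleR_diff_left sum_subtractf scaleR_sum_right)
      also have "\<dots> = y - \<epsilon> *\<^sub>R v"
        using expand[OF bs ys] expand[OF bs span_base[OF vB(2)]] by simp
      finally show ?thesis using cB[of "\<lambda>r u. r *\<^sub>R u"] by simp
    qed
    have "(\<Sum>u\<in>insert v B. c u * w u) = \<epsilon> * w v + (\<Sum>u\<in>B. crd B y u * w u) - \<epsilon> * (\<Sum>u\<in>B. crd B v u * w u)"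
      by (simp add: cB[of "\<lambda>r u. r * w u"] left_diff_distrib sum_subtractf sum_distrib_left mult.assoc)
    also have "\<dots> < cost B"
      using e(1) gt by (simp add: cost_def)
    finally have lt: "(\<Sum>u\<in>insert v B. c u * w u) < cost B" .
    have "insert v B \<subseteq> V" "\<And>u. u \<in> insert v B \<Longrightarrow> c u \<ge> 0"
      using vB BD e by (auto simp: c_def less_imp_le)
    with weighted_caratheodory[of "insert v B" c w] obtain B' where
      "B' \<in> F" "cost B' \<le> (\<Sum>u\<in>insert v B. c u * w u)"
      unfolding cy F_def cost_def by auto
    then show False using B(2)[of B'] lt by simp
  qed
  then show ?thesis using bs pos by (intro bexI[of _ B]) (auto simp: tiles_def)
qed

end

section \<open>Perturbation by a generic point and half-open cones\<close>

lemma eventually_sign_at_right_0: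
  assumes "b \<noteq> (0::real)"
  shows "\<forall>\<^sub>F \<epsilon> in at_right 0. a + \<epsilon> * b \<noteq> 0 \<and> (a + \<epsilon> * b > 0 \<longleftrightarrow> a > 0 \<or> a = 0 \<and> b > 0)"
proof -
  have lim: "((\<lambda>\<epsilon>. a + \<epsilon> * b) \<longlongrightarrow> a + 0 * b) (at_right 0)" by (intro tendsto_intros)
  consider "a > 0" | "a < 0" | "a = 0" by linarith
  then show ?thesis
  proof cases
    case 1
    then have "\<forall>\<^sub>F \<epsilon> in at_right 0. a + \<epsilon> * b > 0"
      using order_tendstoD(1)[OF lim] by simp
    then show ?thesis by eventually_elim (use 1 in auto)
  next
    case 2
    then have "\<forall>\<^sub>F \<epsilon> in at_right 0. a + \<epsilon> * b < 0"
      using order_tendstoD(2)[OF lim] by simp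
    then show ?thesis by eventually_elim (use 2 in auto)
  next
    case 3
    show ?thesis
      using eventually_at_right_less[of "0::real"]
      by eventually_elim (use 3 assms in \<open>auto simp: zero_less_mult_iff\<close>)
  qed
qed

context height_config
begin

text \<open>Each coordinate form is 1 at its own basis element, so the finitely many forms can be
  avoided. Positive coefficients keep \<open>q\<close> in the cone.\<close>

lemma exists_generic_point: "\<exists>q\<in>pos_cone. generic q"
proof -
  define C where "C = (\<lambda>(B,b) u. crd B u b) ` (SIGMA B:bases. B)"
  have "finite C" unfolding C_def using finite_bases basesD by auto
  moreover have "\<exists>v\<in>V. c v \<noteq> 0" if c: "c \<in> C" for c
  proof -
    obtain B b where "B \<in> bases" "b \<in> B" "c = (\<lambda>u. crd B u b)" using c by (auto simp: C_def)
    then show ?thesis using basesD crd_basis[of B b b] by (intro bexI[of _ b]) auto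
  qed
  ultimately obtain \<mu> where \<mu>: "\<And>v. \<mu> v > 0" "\<forall>c\<in>C. (\<Sum>v\<in>V. c v * \<mu> v) \<noteq> 0"
    using avoid_hyperplanes[of C V] finV by auto
  define q where "q = (\<Sum>v\<in>V. \<mu> v *\<^sub>R v)"
  have "crd B q b \<noteq> 0" if "B \<in> bases" "b \<in> B" for B b
  proof -
    have I: "independent B" using that basesD by auto
    have "crd B q b = (\<Sum>v\<in>V. crd B v b * \<mu> v)"
      by (simp add: q_def linear_sum[OF linear_crd[OF I]] linear_scale[OF linear_crd[OF I]] mult.commute)
    then show ?thesis using \<mu>(2) that by (force simp: C_def)
  qed
  moreover have "q \<in> pos_cone" unfolding q_def using \<mu>(1) by (intro comb_in_cone) (auto simp: less_imp_le)
  ultimately show ?thesis using cone_span by (auto simp: generic_def)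
qed

text \<open>Positivity of \<open>t + \<epsilon> * crd B q b\<close> for infinitesimal
  \<open>\<epsilon> > 0\<close>. It decides which facets a half-open cone retains.\<close>

definition admissible :: "'b \<Rightarrow> 'b set \<Rightarrow> 'b \<Rightarrow> real \<Rightarrow> bool" where
  "admissible q B b t \<longleftrightarrow> t > 0 \<or> t = 0 \<and> crd B q b > 0"

text \<open>The points of the simplicial cone over \<open>B\<close> that stay in it when moved slightly towards \<open>q\<close>.\<close>

definition half_open :: "'b \<Rightarrow> 'b set \<Rightarrow> 'b set" where
  "half_open q B = {x\<in>span V. \<forall>b\<in>B. admissible q B b (crd B x b)}"

text \<open>There are finitely many bases and coordinates, so one range of \<open>\<epsilon>\<close>
  serves them all. Half-open membership of \<open>x\<close> thus becomes interior membership of a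
  generic point.\<close>

lemma eventually_perturbed:
  assumes x: "x \<in> span V" and q: "generic q"
  shows "\<forall>\<^sub>F \<epsilon> in at_right 0. generic (x + \<epsilon> *\<^sub>R q) \<and>
    (\<forall>B\<in>bases. \<forall>b\<in>B. crd B (x + \<epsilon> *\<^sub>R q) b > 0 \<longleftrightarrow> admissible q B b (crd B x b))"
proof -
  have "\<forall>\<^sub>F \<epsilon> in at_right 0. \<forall>B\<in>bases. \<forall>b\<in>B. crd B (x + \<epsilon> *\<^sub>R q) b \<noteq> 0 \<and>
    (crd B (x + \<epsilon> *\<^sub>R q) b > 0 \<longleftrightarrow> admissible q B b (crd B x b))"
  proof (intro eventually_ball_finite finite_bases ballI)
    fix B b assume B: "B \<in> bases" and b: "b \<in> B"
    have "crd B q b \<noteq> 0" using q B b by (auto simp: generic_def)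
    from eventually_sign_at_right_0[OF this, of "crd B x b"]
    show "\<forall>\<^sub>F \<epsilon> in at_right 0. crd B (x + \<epsilon> *\<^sub>R q) b \<noteq> 0 \<and>
      (crd B (x + \<epsilon> *\<^sub>R q) b > 0 \<longleftrightarrow> admissible q B b (crd B x b))"
      using basesD(2)[OF B] by (simp add: crd_add crd_scale admissible_def)
  qed (use basesD in auto)
  then show ?thesis
    by eventually_elim (use x q in \<open>auto simp: generic_def span_add span_scale\<close>)
qed

lemma half_open_cone: "B \<in> bases \<Longrightarrow> half_open q B \<subseteq> pos_cone"
  using in_cone_crd by (fastforce simp: half_open_def admissible_def)

text \<open>A small shift towards \<open>q\<close> makes \<open>x\<close> generic and keeps it in
  the cone. The shifted point is interior to exactly one tile, by \<open>tile_exists\<close> and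
  \<open>tile_unique\<close>.\<close>

lemma half_open_partition:
  assumes w: "generic_weight w" and q: "generic q" "q \<in> pos_cone" and x: "x \<in> pos_cone"
  shows "\<exists>!B. B \<in> tiles w \<and> x \<in> half_open q B"
proof -
  have xs: "x \<in> span V" using x cone_span by auto
  have "\<forall>\<^sub>F \<epsilon> in at_right (0::real). \<epsilon> > 0 \<and> generic (x + \<epsilon> *\<^sub>R q) \<and>
    (\<forall>B\<in>bases. \<forall>b\<in>B. crd B (x + \<epsilon> *\<^sub>R q) b > 0 \<longleftrightarrow> admissible q B b (crd B x b))"
    by (rule eventually_conj[OF eventually_at_right_less eventually_perturbed[OF xs q(1)]])
  from eventually_happens'[OF trivial_limit_at_right_real this]
  obtain \<epsilon> :: real where e: "\<epsilon> > 0" "generic (x + \<epsilon> *\<^sub>R q)"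
    "\<And>B b. B \<in> bases \<Longrightarrow> b \<in> B \<Longrightarrow> crd B (x + \<epsilon> *\<^sub>R q) b > 0 \<longleftrightarrow> admissible q B b (crd B x b)"
    by auto
  have y: "x + \<epsilon> *\<^sub>R q \<in> pos_cone" using e x q by (intro cone_add cone_scale) auto
  have iff: "x \<in> half_open q B \<longleftrightarrow> (\<forall>b\<in>B. crd B (x + \<epsilon> *\<^sub>R q) b > 0)" if "B \<in> tiles w" for B
    using that e xs by (auto simp: half_open_def tiles_def)
  have sp: "x + \<epsilon> *\<^sub>R q \<in> span V" using y cone_span by auto
  show ?thesis
  proof (rule ex_ex1I)
    show "\<exists>B. B \<in> tiles w \<and> x \<in> half_open q B"
      using tile_exists[OF w e(2) y] iff by auto
    fix B B' assume "B \<in> tiles w \<and> x \<in> half_open q B" "B' \<in> tiles w \<and> x \<in> half_open q B'"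
    then show "B = B'"
      using iff[of B] iff[of B'] tile_unique[OF _ _ _ _ sp, of B w B'] tile_unique[OF _ _ _ _ sp, of B' w B]
      by (intro subset_antisym) simp_all
  qed
qed

text \<open>The mirror image of the previous argument, with the shift directed towards
  \<open>- q\<close>. The assumption \<open>inner\<close> keeps the shifted point in the cone, and a
  zero coordinate of \<open>x\<close> can become positive only where \<open>q\<close> has a negative
  one.\<close>

lemma exit_tile:
  assumes w: "generic_weight w" and q: "generic q" and x: "x \<in> span V"
    and inner: "\<forall>\<^sub>F \<epsilon> in at_right 0. x - \<epsilon> *\<^sub>R q \<in> pos_cone"
  shows "\<exists>B\<in>tiles w. \<forall>b\<in>B. crd B x b > 0 \<or> crd B x b = 0 \<and> crd B q b < 0"
proof -
  have mq: "generic (- q)"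
    using q basesD(2) by (auto simp: generic_def span_neg crd_neg)
  have "\<forall>\<^sub>F \<epsilon> in at_right 0. x - \<epsilon> *\<^sub>R q \<in> pos_cone \<and> generic (x + \<epsilon> *\<^sub>R (- q)) \<and>
    (\<forall>B\<in>bases. \<forall>b\<in>B. crd B (x + \<epsilon> *\<^sub>R (- q)) b > 0 \<longleftrightarrow> admissible (- q) B b (crd B x b))"
    by (rule eventually_conj[OF inner eventually_perturbed[OF x mq]])
  from eventually_happens'[OF trivial_limit_at_right_real this]
  obtain \<epsilon> where e: "x - \<epsilon> *\<^sub>R q \<in> pos_cone" "generic (x + \<epsilon> *\<^sub>R (- q))"
    "\<And>B b. B \<in> bases \<Longrightarrow> b \<in> B \<Longrightarrow> crd B (x + \<epsilon> *\<^sub>R (- q)) b > 0 \<longleftrightarrow> admissible (- q) B b (crd B x b)"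
    by auto
  from tile_exists[OF w e(2)] e(1) obtain B where B: "B \<in> tiles w"
    "\<forall>b\<in>B. crd B (x + \<epsilon> *\<^sub>R (- q)) b > 0" by auto
  then have bs: "B \<in> bases" by (auto simp: tiles_def)
  show ?thesis
    using B e(3)[OF bs] crd_neg[OF basesD(2)[OF bs]]
    by (intro bexI[of _ B]) (auto simp: admissible_def)
qed

end

section \<open>The Ehrhart series of a height configuration\<close>

text \<open>\<open>L\<close> is a subgroup, later the product of the lattice with the integers.
  Discreteness enters through \<open>finite_level\<close>.\<close>

locale lattice_config = height_config V h
  for V :: "'b::real_vector set" and h :: "'b \<Rightarrow> real" +
  fixes L :: "'b set"
  assumes L_zero: "0 \<in> L" and L_diff: "\<And>x y. x \<in> L \<Longrightarrow> y \<in> L \<Longrightarrow> x - y \<in> L"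
    and V_L: "V \<subseteq> L" and h_int: "\<And>x. x \<in> L \<Longrightarrow> h x \<in> \<int>"
    and finite_level: "\<And>k. finite {x \<in> L \<inter> pos_cone. h x = real k}"
begin

lemma L_neg: "x \<in> L \<Longrightarrow> - x \<in> L"
  using L_diff[OF L_zero] by simp

lemma L_add: "x \<in> L \<Longrightarrow> y \<in> L \<Longrightarrow> x + y \<in> L"
  using L_diff[OF _ L_neg] by force

lemma L_int_scale:
  assumes "x \<in> L"
  shows "of_int z *\<^sub>R x \<in> L"
proof -
  have nat: "of_nat m *\<^sub>R x \<in> L" for m
    by (induction m) (auto simp: L_zero algebra_simps intro: L_add assms)
  show ?thesis
  proof (cases z)
    case (nonneg m) then show ?thesis using nat[of m] by simp
  next
    case (neg m)
    then have "of_int z *\<^sub>R x = - (of_nat (Suc m) *\<^sub>R x)"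
      by (simp flip: scaleR_minus_left)
    then show ?thesis using L_neg[OF nat[of "Suc m"]] by metis
  qed
qed

lemma L_sum: "(\<And>i. i \<in> I \<Longrightarrow> f i \<in> L) \<Longrightarrow> sum f I \<in> L"
  by (induction I rule: infinite_finite_induct) (auto simp: L_zero L_add)

lemma L_int_comb: "S \<subseteq> V \<Longrightarrow> (\<And>v. v \<in> S \<Longrightarrow> c v \<in> \<int>) \<Longrightarrow> (\<Sum>v\<in>S. c v *\<^sub>R v) \<in> L"
proof (rule L_sum)
  fix v assume "S \<subseteq> V" "\<And>v. v \<in> S \<Longrightarrow> c v \<in> \<int>" "v \<in> S"
  then obtain z where "c v = of_int z" "v \<in> L" using V_L by (metis Ints_cases subset_iff)
  then show "c v *\<^sub>R v \<in> L" using L_int_scale by simp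
qed

definition series :: "int fps" where
  "series = Abs_fps (\<lambda>k. int (card {x \<in> L \<inter> pos_cone. h x = real k}))"

text \<open>
  The coordinates in \<open>J\<close> are arbitrary, the remaining ones lie in a half-open unit interval:
  \<open>layer q B B\<close> consists of all lattice points of the half-open cone, \<open>layer q B {}\<close> of those
  in its fundamental box.
\<close>

definition layer :: "'b \<Rightarrow> 'b set \<Rightarrow> 'b set \<Rightarrow> nat \<Rightarrow> 'b set" where
  "layer q B J k = {x \<in> L \<inter> half_open q B. h x = real k \<and>
     (\<forall>b\<in>B - J. \<not> admissible q B b (crd B x b - 1))}"

definition layer_series :: "'b \<Rightarrow> 'b set \<Rightarrow> 'b set \<Rightarrow> int fps" where
  "layer_series q B J = Abs_fps (\<lambda>k. int (card (layer q B J k)))"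

lemma finite_layer: "B \<in> bases \<Longrightarrow> finite (layer q B J k)"
  using half_open_cone by (intro finite_subset[OF _ finite_level[of k]]) (auto simp: layer_def)

text \<open>Subtracting \<open>j\<close> lowers the height by one and is possible exactly for the
  points beyond the unit interval in direction \<open>j\<close>. The count at height
  \<open>k + 1\<close> is therefore that of the smaller layer plus the count at height
  \<open>k\<close>, which is what multiplication by \<open>1 - fps_X\<close> expresses.\<close>

lemma layer_series_insert:
  assumes B: "B \<in> bases" and j: "j \<in> B" "j \<notin> J"
  shows "layer_series q B (insert j J) * (1 - fps_X) = layer_series q B J"
proof -
  note BD = basesD[OF B]
  have jV: "j \<in> V" using j BD by auto
  have cj: "crd B (x + j) b = crd B x b + (if b = j then 1 else 0)" for x b
    using crd_add[OF BD(2)] crd_basis[OF BD(2) j(1)] by simp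
  have cj': "crd B (x - j) b = crd B x b - (if b = j then 1 else 0)" for x b
    using crd_diff[OF BD(2)] crd_basis[OF BD(2) j(1)] by simp
  have hj: "h (x - j) = h x - 1" "h (x + j) = h x + 1" for x
    using linear_diff[OF lin_h] linear_add[OF lin_h] h_one[OF jV] by auto
  have jL: "j \<in> L" "j \<in> span V" using jV V_L by (auto intro: span_base)
  have shift: "x - j \<in> layer q B (insert j J) k"
    if x: "x \<in> layer q B (insert j J) (Suc k)" and a: "admissible q B j (crd B x j - 1)" for x k
    using x a L_diff[OF _ jL(1)] span_diff[OF _ jL(2)]
    by (simp add: layer_def half_open_def cj' hj)
  have adm_Suc: "admissible q B b t \<Longrightarrow> admissible q B b (t + 1)" for b t
    by (auto simp: admissible_def)
  have unshift: "x + j \<in> layer q B (insert j J) (Suc k) \<and> admissible q B j (crd B (x + j) j - 1)"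
    if x: "x \<in> layer q B (insert j J) k" for x k
    using x j L_add[OF _ jL(1)] span_add[OF _ jL(2)] adm_Suc
    by (auto simp: layer_def half_open_def cj hj)
  have sub: "layer q B J k = {x \<in> layer q B (insert j J) k. \<not> admissible q B j (crd B x j - 1)}" for k
  proof -
    have "B - J = insert j (B - insert j J)" using j by auto
    then show ?thesis by (auto simp only: layer_def ball_simps)
  qed
  \<comment> \<open>At height 0 nothing can be subtracted: the result would be a cone point of
    height -1.\<close>
  have z: "layer q B J 0 = layer q B (insert j J) 0"
  proof -
    have "\<not> admissible q B j (crd B x j - 1)" if x: "x \<in> layer q B (insert j J) 0" for x
    proof
      assume a: "admissible q B j (crd B x j - 1)"
      have "x - j \<in> half_open q B"
        using x a span_diff[OF _ jL(2)] by (simp add: layer_def half_open_def cj')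
      then have "h (x - j) \<ge> 0" using half_open_cone[OF B] h_cone_nonneg by auto
      then show False using x by (simp add: layer_def hj)
    qed
    then show ?thesis unfolding sub by blast
  qed
  have s: "card (layer q B (insert j J) (Suc k)) = card (layer q B J (Suc k)) + card (layer q B (insert j J) k)" for k
  proof -
    have "layer q B (insert j J) (Suc k) = layer q B J (Suc k) \<union> (\<lambda>x. x + j) ` layer q B (insert j J) k"
    proof (intro equalityI subsetI)
      fix x assume x: "x \<in> layer q B (insert j J) (Suc k)"
      show "x \<in> layer q B J (Suc k) \<union> (\<lambda>x. x + j) ` layer q B (insert j J) k"
      proof (cases "admissible q B j (crd B x j - 1)")
        case True
        show ?thesis using image_eqI[of x "\<lambda>x. x + j" "x - j"] shift[OF x True] by simp
      qed (use x in \<open>simp add: sub\<close>)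
    next
      fix x assume "x \<in> layer q B J (Suc k) \<union> (\<lambda>x. x + j) ` layer q B (insert j J) k"
      then show "x \<in> layer q B (insert j J) (Suc k)"
        using conjunct1[OF unshift[of _ k]] unfolding sub by blast
    qed
    moreover have "layer q B J (Suc k) \<inter> (\<lambda>x. x + j) ` layer q B (insert j J) k = {}"
      using conjunct2[OF unshift[of _ k]] unfolding sub by blast
    ultimately show ?thesis using finite_layer[OF B] by (simp add: card_Un_disjoint card_image)
  qed
  show ?thesis
  proof (rule fps_ext)
    fix k
    show "fps_nth (layer_series q B (insert j J) * (1 - fps_X)) k = fps_nth (layer_series q B J) k"
      using z s by (cases k) (auto simp: layer_series_def right_diff_distrib fps_X_mult_right_nth)
  qed
qed

lemma layer_series_box:
  assumes B: "B \<in> bases"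
  shows "layer_series q B B * (1 - fps_X) ^ card B = layer_series q B {}"
proof -
  have "layer_series q B J * (1 - fps_X) ^ card J = layer_series q B {}" if "finite J" "J \<subseteq> B" for J
    using that
  proof (induction J rule: finite_induct)
    case (insert j J)
    then show ?case
      using layer_series_insert[OF B, of j J q] by (simp add: mult.assoc[symmetric])
  qed simp
  then show ?thesis using basesD(4)[OF B] by auto
qed

section \<open>The h*-polynomial as a count of box points\<close>

lemma box_height:
  assumes B: "B \<in> bases" and x: "x \<in> layer q B {} k"
  shows "k \<le> dim V"
proof -
  have "crd B x b \<le> 1" if "b \<in> B" for b
    using x that by (fastforce simp: layer_def admissible_def)
  then have "(\<Sum>b\<in>B. crd B x b) \<le> (\<Sum>b\<in>B. 1)" by (rule sum_mono)
  then have "h x \<le> (\<Sum>b\<in>B. 1)"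
    using x h_expand[OF B, of x] by (simp add: layer_def half_open_def)
  then show ?thesis using x card_bases[OF B] by (simp add: layer_def)
qed

text \<open>This will be the h*-polynomial. The coefficients are sums of cardinalities, so a single
  box point at height \<open>k\<close> already forces the degree to be at least \<open>k\<close>. By
  \<open>box_height\<close> the cut at \<open>dim V\<close> loses nothing.\<close>

definition box_poly :: "('b \<Rightarrow> real) \<Rightarrow> 'b \<Rightarrow> int poly" where
  "box_poly w q = (\<Sum>k\<le>dim V. monom (\<Sum>B\<in>tiles w. int (card (layer q B {} k))) k)"

lemma finite_tiles: "finite (tiles w)"
  using finite_bases by (auto simp: tiles_def)

lemma coeff_box_poly: "coeff (box_poly w q) k = (\<Sum>B\<in>tiles w. int (card (layer q B {} k)))"
proof -
  have "(\<Sum>B\<in>tiles w. int (card (layer q B {} k))) = 0" if "\<not> k \<le> dim V"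
  proof (intro sum.neutral ballI)
    fix B assume "B \<in> tiles w"
    then have "layer q B {} k = {}" using that box_height by (auto simp: tiles_def)
    then show "int (card (layer q B {} k)) = 0" by simp
  qed
  then show ?thesis
    by (auto simp: box_poly_def coeff_sum coeff_monom)
qed

text \<open>The half-open tiles partition the lattice points at each height. All tiles have
  \<open>dim V\<close> generators, so their series share the denominator
  \<open>(1 - fps_X) ^ dim V\<close>.\<close>

lemma series_rational:
  assumes w: "generic_weight w" and q: "generic q" "q \<in> pos_cone"
  shows "fps_of_poly (box_poly w q) = series * (1 - fps_X) ^ dim V"
proof -
  have "card {x \<in> L \<inter> pos_cone. h x = real k} = (\<Sum>B\<in>tiles w. card (layer q B B k))" for k
  proof -
    have ll: "layer q B B k = {x \<in> L \<inter> half_open q B. h x = real k}" for B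
      by (simp add: layer_def)
    have hc: "half_open q B \<subseteq> pos_cone" if "B \<in> tiles w" for B
      using half_open_cone that by (simp add: tiles_def)
    have "{x \<in> L \<inter> pos_cone. h x = real k} = (\<Union>B\<in>tiles w. layer q B B k)"
    proof (intro equalityI subsetI)
      fix x assume x: "x \<in> {x \<in> L \<inter> pos_cone. h x = real k}"
      then obtain B where "B \<in> tiles w" "x \<in> half_open q B"
        using half_open_partition[OF w q, of x] by auto
      then show "x \<in> (\<Union>B\<in>tiles w. layer q B B k)" using x unfolding ll by auto
    qed (use hc in \<open>auto simp: ll\<close>)
    moreover have "card (\<Union>B\<in>tiles w. layer q B B k) = (\<Sum>B\<in>tiles w. card (layer q B B k))"
    proof (rule card_UN_disjoint)
      show "\<forall>B\<in>tiles w. \<forall>B'\<in>tiles w. B \<noteq> B' \<longrightarrow> layer q B B k \<inter> layer q B' B' k = {}"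
      proof (intro ballI impI equals0I)
        fix B B' x assume B: "B \<in> tiles w" "B' \<in> tiles w" "B \<noteq> B'"
          and "x \<in> layer q B B k \<inter> layer q B' B' k"
        then have x: "x \<in> half_open q B" "x \<in> half_open q B'" by (auto simp: ll)
        then have "x \<in> pos_cone" using hc[OF B(1)] by auto
        from half_open_partition[OF w q this] show False using B x by auto
      qed
    qed (use finite_tiles finite_layer in \<open>auto simp: tiles_def\<close>)
    ultimately show ?thesis by simp
  qed
  then have "series = (\<Sum>B\<in>tiles w. layer_series q B B)"
    by (intro fps_ext) (simp add: series_def layer_series_def fps_sum_nth)
  then have "series * (1 - fps_X) ^ dim V = (\<Sum>B\<in>tiles w. layer_series q B B * (1 - fps_X) ^ dim V)"
    by (simp add: sum_distrib_right)
  also have "\<dots> = (\<Sum>B\<in>tiles w. layer_series q B {})"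
    by (intro sum.cong refl) (metis (mono_tags, lifting) card_bases layer_series_box mem_Collect_eq tiles_def)
  also have "\<dots> = fps_of_poly (box_poly w q)"
    by (intro fps_ext) (simp add: layer_series_def fps_sum_nth coeff_box_poly)
  finally show ?thesis by simp
qed

text \<open>
  The part of Ehrhart reciprocity that is needed: the box of the tile through which the ray
  from the generic point \<open>q\<close> leaves \<open>x\<close> contains a point congruent to \<open>- x\<close>, all of whose
  coordinates are at least those of \<open>\<Sum>B - x\<close>.
\<close>

lemma interior_height_bound:
  assumes w: "generic_weight w" and q: "generic q"
    and x: "x \<in> L" "x = (\<Sum>v\<in>S. a v *\<^sub>R v)" "\<And>v. v \<in> S \<Longrightarrow> a v > 0"
    and S: "S \<subseteq> V" "span S = span V"
  shows "real (dim V) \<le> h x + real (degree (box_poly w q))"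
proof -
  have finS: "finite S" using S finV finite_subset by auto
  have xs: "x \<in> span V" using comb_in_span[OF S(1)] x by simp
  \<comment> \<open>With \<open>q\<close> written over \<open>S\<close>, the positive coefficients
    of \<open>x\<close> stay positive after subtracting a small multiple of
    \<open>q\<close>.\<close>
  have "q \<in> span S" using q S by (simp add: generic_def)
  then obtain c where c: "q = (\<Sum>v\<in>S. c v *\<^sub>R v)" using finS by (auto simp: span_finite)
  have "\<forall>\<^sub>F \<epsilon> in at_right 0. \<forall>v\<in>S. a v - \<epsilon> * c v > 0"
  proof (intro eventually_ball_finite finS ballI)
    fix v assume v: "v \<in> S"
    have "((\<lambda>\<epsilon>. a v - \<epsilon> * c v) \<longlongrightarrow> a v - 0 * c v) (at_right 0)"
      by (intro tendsto_intros)
    then show "\<forall>\<^sub>F \<epsilon> in at_right 0. a v - \<epsilon> * c v > 0"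
      using x(3)[OF v] by (intro order_tendstoD(1)[where y = "a v"]) auto
  qed
  then have "\<forall>\<^sub>F \<epsilon> in at_right 0. x - \<epsilon> *\<^sub>R q \<in> pos_cone"
  proof eventually_elim
    case (elim \<epsilon>)
    have "x - \<epsilon> *\<^sub>R q = (\<Sum>v\<in>S. (a v - \<epsilon> * c v) *\<^sub>R v)"
      by (simp add: x(2) c scaleR_diff_left sum_subtractf scaleR_sum_right)
    then show ?case using comb_in_cone[OF S(1)] elim by (simp add: less_imp_le)
  qed
  from exit_tile[OF w q xs this] obtain B where B: "B \<in> tiles w"
    "\<And>b. b \<in> B \<Longrightarrow> crd B x b > 0 \<or> crd B x b = 0 \<and> crd B q b < 0" by auto
  have bs: "B \<in> bases" using B by (auto simp: tiles_def)
  note BD = basesD[OF bs]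
  \<comment> \<open>The representative of \<open>- crd B x b\<close> modulo 1 in the interval that
    the half-open box prescribes: \<open>(0, 1]\<close> where \<open>q\<close> has a negative
    coordinate, \<open>[0, 1)\<close> elsewhere.\<close>
  define \<beta> where "\<beta> b = (if crd B x b \<in> \<int> then (if crd B q b < 0 then 1 else 0)
    else of_int \<lceil>crd B x b\<rceil> - crd B x b)" for b
  define y where "y = (\<Sum>b\<in>B. \<beta> b *\<^sub>R b)"
  have cy: "crd B y b = \<beta> b" if "b \<in> B" for b
    unfolding y_def using crd_sum[OF BD(2,4) that] .
  have int: "\<beta> b + crd B x b \<in> \<int>" for b by (auto simp: \<beta>_def)
  have range: "admissible q B b (\<beta> b) \<and> \<not> admissible q B b (\<beta> b - 1)" if "b \<in> B" for b
  proof (cases "crd B x b \<in> \<int>")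
    case True
    have "crd B q b \<noteq> 0" using q bs that by (auto simp: generic_def)
    then show ?thesis using True by (auto simp: \<beta>_def admissible_def)
  next
    case False
    then have "of_int \<lceil>crd B x b\<rceil> \<noteq> crd B x b" by (metis Ints_of_int)
    then have "of_int \<lceil>crd B x b\<rceil> - crd B x b > 0" "of_int \<lceil>crd B x b\<rceil> - crd B x b < 1"
      using ceiling_correct[of "crd B x b"] by linarith+
    then show ?thesis using False by (auto simp: \<beta>_def admissible_def)
  qed
  \<comment> \<open>A zero coordinate of \<open>x\<close> occurs only where \<open>q\<close> is
    negative, and there \<open>\<beta> b = 1\<close>. So the sum is positive, and being an integer
    it is at least 1.\<close>
  have ge: "\<beta> b + crd B x b \<ge> 1" if "b \<in> B" for b
  proof -
    have "\<beta> b \<ge> 0" using range[OF that] by (auto simp: admissible_def)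
    then have "\<beta> b + crd B x b > 0" using B(2)[OF that] by (auto simp: \<beta>_def)
    moreover obtain z where z: "\<beta> b + crd B x b = of_int z" using int by (auto elim: Ints_cases)
    ultimately have "z \<ge> 1" by auto
    then show ?thesis using z by simp
  qed
  have "y = (\<Sum>b\<in>B. (\<beta> b + crd B x b) *\<^sub>R b) - x"
    using expand[OF bs xs] by (simp add: y_def scaleR_add_left sum.distrib)
  then have yL: "y \<in> L" using L_diff[OF L_int_comb[OF BD(1) int] x(1)] by simp
  have ys: "y \<in> half_open q B"
    using comb_in_span[OF BD(1)] cy range by (simp add: half_open_def y_def)
  then have "h y \<ge> 0" using half_open_cone[OF bs] h_cone_nonneg by auto
  then obtain k where k: "h y = real k"
    using h_int[OF yL] by (auto elim!: Ints_cases simp: of_int_of_nat zle_iff_zadd)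
  have "y \<in> layer q B {} k" using yL ys k cy range by (auto simp: layer_def)
  then have "card (layer q B {} k) > 0" using finite_layer[OF bs] by (auto simp: card_gt_0_iff)
  then have "coeff (box_poly w q) k > 0"
    unfolding coeff_box_poly using B(1) finite_tiles by (intro sum_pos2[of _ B]) auto
  then have "k \<le> degree (box_poly w q)" by (intro le_degree) simp
  moreover have "real (dim V) \<le> h x + h y"
  proof -
    have "real (dim V) = (\<Sum>b\<in>B. 1)" using card_bases[OF bs] by simp
    also have "\<dots> \<le> (\<Sum>b\<in>B. \<beta> b + crd B x b)" by (intro sum_mono ge)
    also have "\<dots> = h x + h y"
      using h_expand[OF bs xs] h_sum[OF BD(1)] by (simp add: y_def sum.distrib)
    finally show ?thesis .
  qed
  ultimately show ?thesis using k by simp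
qed

text \<open>All that the rest of the argument uses about the degree. Interior points of the cone are
  encoded as positive combinations of a spanning subset, and the sum of the coefficients is their
  height.\<close>

definition codegree_bound :: "nat \<Rightarrow> bool" where
  "codegree_bound d \<longleftrightarrow> (\<forall>S. \<forall>a::'b \<Rightarrow> real. S \<subseteq> V \<longrightarrow> span S = span V \<longrightarrow> (\<forall>v\<in>S. a v > 0) \<longrightarrow>
     (\<Sum>v\<in>S. a v *\<^sub>R v) \<in> L \<longrightarrow> dim V \<le> (\<Sum>v\<in>S. a v) + d)"

lemma codegree_boundD:
  fixes a :: "'b \<Rightarrow> real"
  assumes "codegree_bound d" "S \<subseteq> V" "span S = span V" "\<And>v. v \<in> S \<Longrightarrow> a v > 0"
    "(\<Sum>v\<in>S. a v *\<^sub>R v) \<in> L"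
  shows "dim V \<le> (\<Sum>v\<in>S. a v) + d"
  using assms unfolding codegree_bound_def by blast

lemma codegree_bound_mono: "codegree_bound d \<Longrightarrow> d \<le> d' \<Longrightarrow> codegree_bound d'"
  unfolding codegree_bound_def by (meson add_left_mono of_nat_mono order.trans)

text \<open>The auxiliary choices of \<open>w\<close> and \<open>q\<close> end here; the polynomial
  is determined by the series alone.\<close>

theorem series_poly:
  obtains p where "fps_of_poly p = series * (1 - fps_X) ^ dim V" "codegree_bound (degree p)"
proof -
  obtain w q where wq: "generic_weight w" "generic q" "q \<in> pos_cone"
    using exists_generic_weight exists_generic_point by auto
  have "codegree_bound (degree (box_poly w q))"
    unfolding codegree_bound_def
  proof (intro allI impI)
    fix S and a :: "'b \<Rightarrow> real"
    assume S: "S \<subseteq> V" "span S = span V" "\<forall>v\<in>S. a v > 0" "(\<Sum>v\<in>S. a v *\<^sub>R v) \<in> L"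
    show "real (dim V) \<le> (\<Sum>v\<in>S. a v) + real (degree (box_poly w q))"
      using interior_height_bound[OF wq(1,2) S(4) refl _ S(1,2)] S(3) h_sum[OF S(1)] by simp
  qed
  with series_rational[OF wq] show thesis by (rule that)
qed

end

section \<open>Simplices and circuits\<close>

context lattice_config
begin

text \<open>Representatives of the finite group of lattice points in \<open>span V\<close> modulo
  the integer span of \<open>B\<close>. Unlike the boxes of the tiling, this one is closed below and
  open above in every direction.\<close>

definition unit_box :: "'b set \<Rightarrow> 'b set" where
  "unit_box B = {x \<in> L \<inter> span V. \<forall>b\<in>B. 0 \<le> crd B x b \<and> crd B x b < 1}"

definition reduce :: "'b set \<Rightarrow> 'b \<Rightarrow> 'b" where
  "reduce B x = (\<Sum>b\<in>B. frac (crd B x b) *\<^sub>R b)"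

definition supp :: "'b set \<Rightarrow> 'b \<Rightarrow> 'b set" where
  "supp B x = {b\<in>B. crd B x b \<noteq> 0}"

context
  fixes B
  assumes B: "B \<in> bases"
begin

lemma crd_reduce: "b \<in> B \<Longrightarrow> crd B (reduce B x) b = frac (crd B x b)"
  unfolding reduce_def using crd_sum[OF basesD(2)[OF B] basesD(4)[OF B]] .

lemma reduce_box:
  assumes "x \<in> L" "x \<in> span V"
  shows "reduce B x \<in> unit_box B"
proof -
  have "reduce B x = x - (\<Sum>b\<in>B. of_int \<lfloor>crd B x b\<rfloor> *\<^sub>R b)"
    using expand[OF B assms(2)] by (simp add: reduce_def frac_def scaleR_diff_left sum_subtractf)
  then have "reduce B x \<in> L" using assms L_diff L_int_comb[OF basesD(1)[OF B]] by simp
  moreover have "reduce B x \<in> span V" unfolding reduce_def by (rule comb_in_span[OF basesD(1)[OF B]])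
  ultimately show ?thesis by (simp add: unit_box_def crd_reduce frac_lt_1)
qed

lemma box_eqI: "x \<in> unit_box B \<Longrightarrow> y \<in> unit_box B \<Longrightarrow> (\<And>b. b \<in> B \<Longrightarrow> crd B x b = crd B y b) \<Longrightarrow> x = y"
  using expand[OF B, of x] expand[OF B, of y] by (simp add: unit_box_def)

lemma finite_box: "finite (unit_box B)"
proof (rule finite_subset)
  show "unit_box B \<subseteq> (\<Union>k\<le>dim V. {x \<in> L \<inter> pos_cone. h x = real k})"
  proof
    fix x assume x: "x \<in> unit_box B"
    then have xs: "x \<in> span V" "x \<in> L" by (auto simp: unit_box_def)
    have xc: "x \<in> pos_cone" using x xs in_cone_crd[OF B] by (auto simp: unit_box_def)
    have "(\<Sum>b\<in>B. crd B x b) \<le> (\<Sum>b\<in>B. 1)"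
      using x by (intro sum_mono) (auto simp: unit_box_def less_imp_le)
    then have le: "h x \<le> real (dim V)" using h_expand[OF B xs(1)] card_bases[OF B] by simp
    obtain k where "h x = real k"
      using h_int[OF xs(2)] h_cone_nonneg[OF xc] by (auto elim!: Ints_cases simp: of_int_of_nat zle_iff_zadd)
    then show "x \<in> (\<Union>k\<le>dim V. {x \<in> L \<inter> pos_cone. h x = real k})" using le xs xc by auto
  qed
qed (use finite_level in auto)

lemma zero_box: "0 \<in> unit_box B"
  using L_zero linear_0[OF linear_crd[OF basesD(2)[OF B]]] by (auto simp: unit_box_def span_zero)

text \<open>The complement \<open>\<Sum>B - x\<close> has only positive coordinates, so it is an
  interior lattice point. Its height is \<open>dim V - h x\<close>.\<close>

lemma box_height_le:
  assumes d: "codegree_bound d" and x: "x \<in> unit_box B"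
  shows "h x \<le> d"
proof -
  note BD = basesD[OF B]
  have xs: "x \<in> span V" "x \<in> L" using x by (auto simp: unit_box_def)
  have eq: "(\<Sum>b\<in>B. (1 - crd B x b) *\<^sub>R b) = (\<Sum>b\<in>B. 1 *\<^sub>R b) - x"
    using expand[OF B xs(1)] by (simp add: scaleR_diff_left sum_subtractf)
  have "(\<Sum>b\<in>B. (1 - crd B x b) *\<^sub>R b) \<in> L"
    unfolding eq by (intro L_diff xs L_int_comb[OF BD(1)]) auto
  then have "dim V \<le> (\<Sum>b\<in>B. 1 - crd B x b) + d"
    using x codegree_boundD[OF d BD(1,3), of "\<lambda>b. 1 - crd B x b"] by (simp add: unit_box_def)
  also have "(\<Sum>b\<in>B. 1 - crd B x b) = dim V - h x"
    using h_expand[OF B xs(1)] card_bases[OF B] by (simp add: sum_subtractf)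
  finally show ?thesis by simp
qed

text \<open>The heights of \<open>x\<close> and of its inverse in the group of box points add up to the size of the support.\<close>

lemma card_supp_le:
  assumes d: "codegree_bound d" and x: "x \<in> unit_box B"
  shows "card (supp B x) \<le> 2 * d"
proof -
  note BD = basesD[OF B]
  have xs: "x \<in> span V" "x \<in> L" using x by (auto simp: unit_box_def)
  define y where "y = reduce B (- x)"
  have y: "y \<in> unit_box B" unfolding y_def using xs by (intro reduce_box L_neg span_neg)
  have ys: "y \<in> span V" using y by (auto simp: unit_box_def)
  have c: "crd B x b + crd B y b = (if b \<in> supp B x then 1 else 0)" if "b \<in> B" for b
  proof -
    have "frac (crd B x b) = crd B x b" using x that by (simp add: unit_box_def frac_eq)
    then have "crd B x b \<in> \<int> \<longleftrightarrow> crd B x b = 0" by (metis frac_eq_0_iff)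
    then show ?thesis
      using \<open>frac (crd B x b) = crd B x b\<close> that
      by (simp add: y_def crd_reduce crd_neg[OF BD(2)] frac_neg supp_def)
  qed
  have "h x + h y = (\<Sum>b\<in>B. crd B x b + crd B y b)"
    using h_expand[OF B] xs ys by (simp add: sum.distrib)
  also have "\<dots> = (\<Sum>b\<in>B. if b \<in> supp B x then 1 else 0)" using c by (rule sum.cong[OF refl])
  also have "\<dots> = card (supp B x)"
    using BD(4) by (simp add: sum.If_cases supp_def Int_def)
  finally show ?thesis using box_height_le[OF d x] box_height_le[OF d y] by linarith
qed

text \<open>Translation by \<open>g\<close> in the group of box points is injective and moves every
  point with \<open>b\<close>-coordinate 0 to one with a non-zero
  \<open>b\<close>-coordinate.\<close>

lemma card_box_le:
  assumes b: "b \<in> B" and g: "g \<in> unit_box B" "crd B g b \<noteq> 0"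
  shows "card (unit_box B) \<le> 2 * card {x\<in>unit_box B. crd B x b \<noteq> 0}"
proof -
  note BD = basesD[OF B]
  define f where "f x = reduce B (x + g)" for x
  have fb: "f x \<in> unit_box B" if "x \<in> unit_box B" for x
    unfolding f_def using that g(1) by (intro reduce_box L_add span_add) (auto simp: unit_box_def)
  have cf: "crd B (f x) b' = frac (crd B x b' + crd B g b')" if "b' \<in> B" for x b'
    using that by (simp add: f_def crd_reduce crd_add[OF BD(2)])
  have "inj_on f (unit_box B)"
  proof (rule inj_onI, rule box_eqI)
    fix x y b' assume xy: "x \<in> unit_box B" "y \<in> unit_box B" "f x = f y" and b': "b' \<in> B"
    have "frac (crd B x b' + crd B g b') = frac (crd B y b' + crd B g b')"
      using cf[OF b'] xy(3) by metis
    \<comment> \<open>The two coordinates differ by an integer of absolute value less than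
      1.\<close>
    then have "crd B x b' - crd B y b' =
        of_int (\<lfloor>crd B x b' + crd B g b'\<rfloor> - \<lfloor>crd B y b' + crd B g b'\<rfloor>)"
      by (simp add: frac_def)
    moreover have "\<bar>crd B x b' - crd B y b'\<bar> < 1"
      using xy b' by (fastforce simp: unit_box_def)
    ultimately have "\<bar>\<lfloor>crd B x b' + crd B g b'\<rfloor> - \<lfloor>crd B y b' + crd B g b'\<rfloor>\<bar> < 1"
      by linarith
    then show "crd B x b' = crd B y b'"
      using \<open>crd B x b' - crd B y b' = _\<close> by simp
  qed
  then have "inj_on f {x\<in>unit_box B. crd B x b = 0}" by (rule inj_on_subset) auto
  moreover have "f ` {x\<in>unit_box B. crd B x b = 0} \<subseteq> {x\<in>unit_box B. crd B x b \<noteq> 0}"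
  proof (intro image_subsetI CollectI conjI)
    fix x assume x: "x \<in> {x\<in>unit_box B. crd B x b = 0}"
    show "f x \<in> unit_box B" using x fb by simp
    have "crd B (f x) b = crd B g b"
      using x cf[OF b] g(1) b by (simp add: unit_box_def frac_eq)
    then show "crd B (f x) b \<noteq> 0" using g(2) by simp
  qed
  ultimately have "card {x\<in>unit_box B. crd B x b = 0} \<le> card {x\<in>unit_box B. crd B x b \<noteq> 0}"
    using finite_box by (intro card_inj_on_le) auto
  moreover have "card (unit_box B) = card ({x\<in>unit_box B. crd B x b = 0} \<union> {x\<in>unit_box B. crd B x b \<noteq> 0})"
    by (rule arg_cong[where f = card]) auto
  moreover have "\<dots> = card {x\<in>unit_box B. crd B x b = 0} + card {x\<in>unit_box B. crd B x b \<noteq> 0}"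
    using finite_box by (intro card_Un_disjoint) auto
  ultimately show ?thesis by linarith
qed

text \<open>
  Double counting of the pairs of a box point and an element of its support: every \<open>b\<close> in the
  union of the supports lies in at least half of them.
\<close>

lemma card_union_supp:
  assumes d: "codegree_bound d"
  shows "card (\<Union>x\<in>unit_box B. supp B x) \<le> 4 * d - 1"
proof -
  let ?U = "\<Union>x\<in>unit_box B. supp B x" and ?N = "card (unit_box B)"
  have finB: "finite B" using basesD[OF B] by simp
  have finU: "finite ?U" using finB by (intro finite_subset[of ?U B]) (auto simp: supp_def)
  have N: "?N \<ge> 1" using zero_box finite_box by (metis One_nat_def Suc_leI card_gt_0_iff empty_iff)
  have "card ?U * ?N = (\<Sum>b\<in>?U. ?N)" by simp
  also have "\<dots> \<le> (\<Sum>b\<in>?U. 2 * card {x\<in>unit_box B. crd B x b \<noteq> 0})"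
    using card_box_le by (intro sum_mono) (auto simp: supp_def)
  also have "\<dots> = (\<Sum>b\<in>?U. 2 * (\<Sum>x\<in>unit_box B. if b \<in> supp B x then 1 else 0))"
    using finite_box by (intro sum.cong refl) (auto simp: sum.If_cases supp_def Int_def intro!: arg_cong[where f = card])
  also have "\<dots> = 2 * (\<Sum>x\<in>unit_box B. \<Sum>b\<in>?U. if b \<in> supp B x then 1 else 0)"
    by (subst sum.swap) (simp add: sum_distrib_left)
  also have "\<dots> = 2 * (\<Sum>x\<in>unit_box B. card (supp B x))"
    using finU by (intro arg_cong[where f = "(*) 2"] sum.cong refl)
      (auto simp: sum.If_cases intro!: arg_cong[where f = card])
  \<comment> \<open>Dropping 0, whose support is empty, gives the factor \<open>?N - 1\<close> and
    thereby a strict bound for positive \<open>d\<close>.\<close>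
  also have "(\<Sum>x\<in>unit_box B. card (supp B x)) = (\<Sum>x\<in>unit_box B - {0}. card (supp B x))"
    using finite_box linear_0[OF linear_crd[OF basesD(2)[OF B]]]
    by (intro sum.mono_neutral_right) (auto simp: supp_def)
  also have "\<dots> \<le> (\<Sum>x\<in>unit_box B - {0}. 2 * d)"
    using card_supp_le[OF d] by (intro sum_mono) auto
  also have "\<dots> = (?N - 1) * (2 * d)" using zero_box finite_box by simp
  finally have le: "card ?U * ?N \<le> 4 * d * (?N - 1)" by (simp add: mult_ac)
  show ?thesis
  proof (cases "d = 0")
    \<comment> \<open>Here \<open>4 * d - 1\<close> is 0 by truncated subtraction, and
      \<open>le\<close> shows that no coordinate occurs.\<close>
    case True
    then show ?thesis using le N by auto
  next
    case False
    then have "4 * d * (?N - 1) < 4 * d * ?N" using N by simp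
    then have "card ?U < 4 * d" using le by (metis le_less_trans mult_less_cancel2)
    then show ?thesis by simp
  qed
qed

text \<open>Start from \<open>k *\<^sub>R v + \<Sum>A\<close>, where \<open>A\<close> holds the
  basis elements whose coordinate lacks the sign \<open>\<sigma>\<close>. Adding a small multiple of
  the relation between \<open>v\<close> and \<open>B\<close> makes all coefficients positive without
  moving the point, so its height \<open>k + card A\<close> obeys the codegree bound. For
  \<open>\<sigma> = 1\<close> the relation lowers the coefficient of \<open>v\<close>, which
  therefore starts at 1.\<close>

lemma circuit_bound:
  assumes d: "codegree_bound d" and v: "v \<in> V - B" and \<sigma>: "\<sigma> = 1 \<or> \<sigma> = (-1::real)"
  shows "card {b\<in>B. \<sigma> * crd B v b > 0} \<le> d + (if \<sigma> = 1 then 1 else 0)"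
proof -
  note BD = basesD[OF B]
  define A where "A = {b\<in>B. \<sigma> * crd B v b \<le> 0}"
  define k :: real where "k = (if \<sigma> = 1 then 1 else 0)"
  \<comment> \<open>Small enough that neither the coefficient of \<open>v\<close> nor those of the
    elements of \<open>A\<close> can drop to 0.\<close>
  define \<delta> where "\<delta> = 1 / (2 + (\<Sum>b\<in>B. \<bar>crd B v b\<bar>))"
  have s0: "(\<Sum>b\<in>B. \<bar>crd B v b\<bar>) \<ge> 0" by (intro sum_nonneg) auto
  have \<delta>: "\<delta> > 0" "\<delta> < 1" 
  proof -
    have "2 + (\<Sum>b\<in>B. \<bar>crd B v b\<bar>) > 1" using s0 by linarith
    then show "\<delta> > 0" "\<delta> < 1" by (simp_all add: \<delta>_def)
  qed
  have \<delta>c: "\<delta> * \<bar>crd B v b\<bar> < 1" if "b \<in> B" for b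
  proof -
    have "\<bar>crd B v b\<bar> \<le> (\<Sum>b\<in>B. \<bar>crd B v b\<bar>)" using that BD(4) by (intro member_le_sum) auto
    then have "\<bar>crd B v b\<bar> < 2 + (\<Sum>b\<in>B. \<bar>crd B v b\<bar>)" by linarith
    then show ?thesis using s0 by (simp add: \<delta>_def)
  qed
  define a where "a u = (if u = v then k - \<sigma> * \<delta> else (if u \<in> A then 1 else 0) + \<sigma> * \<delta> * crd B v u)" for u
  have vB: "v \<notin> B" "v \<in> V" using v by auto
  have pos: "a u > 0" if "u \<in> insert v B" for u
  proof (cases "u = v")
    case True
    then show ?thesis using \<sigma> \<delta> by (auto simp: a_def k_def)
  next
    case False
    then have u: "u \<in> B" using that by simp
    have "\<bar>\<sigma> * \<delta> * crd B v u\<bar> < 1" using \<delta>c[OF u] \<delta> \<sigma> by (auto simp: abs_mult)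
    moreover have "\<sigma> * \<delta> * crd B v u > 0" if "u \<notin> A"
    proof -
      have "\<delta> * (\<sigma> * crd B v u) > 0" using that u \<delta> by (auto simp: A_def)
      then show ?thesis by (simp add: mult_ac)
    qed
    ultimately show ?thesis using False by (auto simp: a_def)
  qed
  have sm: "(\<Sum>u\<in>insert v B. a u *\<^sub>R u) = k *\<^sub>R v + (\<Sum>u\<in>B. (if u \<in> A then 1 else 0) *\<^sub>R u)"
  proof -
    have "(\<Sum>u\<in>B. a u *\<^sub>R u) = (\<Sum>u\<in>B. ((if u \<in> A then 1 else 0) + \<sigma> * \<delta> * crd B v u) *\<^sub>R u)"
      using vB by (intro sum.cong) (auto simp: a_def)
    also have "\<dots> = (\<Sum>u\<in>B. (if u \<in> A then 1 else 0) *\<^sub>R u) + (\<sigma> * \<delta>) *\<^sub>R (\<Sum>u\<in>B. crd B v u *\<^sub>R u)"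
      by (simp only: scaleR_add_left sum.distrib scaleR_sum_right scaleR_scaleR)
    also have "(\<Sum>u\<in>B. crd B v u *\<^sub>R u) = v" using expand[OF B span_base[OF vB(2)]] by simp
    finally show ?thesis using vB BD(4) by (simp add: a_def scaleR_diff_left)
  qed
  have "k \<in> \<int>" by (simp add: k_def)
  have "(\<Sum>u\<in>insert v B. a u *\<^sub>R u) \<in> L"
    unfolding sm using vB V_L \<open>k \<in> \<int>\<close>
    by (intro L_add L_int_comb[OF BD(1)]) (auto intro: L_int_scale elim!: Ints_cases)
  moreover have sub: "insert v B \<subseteq> V" using vB BD by auto
  moreover have "span (insert v B) = span V"
    using BD sub by (metis span_mono subset_antisym subset_insertI)
  ultimately have "dim V \<le> (\<Sum>u\<in>insert v B. a u) + d"
    using pos by (intro codegree_boundD[OF d]) auto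
  also have "(\<Sum>u\<in>insert v B. a u) = h (\<Sum>u\<in>insert v B. a u *\<^sub>R u)"
    using h_sum[OF sub] by simp
  also have "\<dots> = k + (\<Sum>u\<in>B. if u \<in> A then 1 else 0)"
    unfolding sm using linear_add[OF lin_h] linear_scale[OF lin_h] h_one[OF vB(2)] h_sum[OF BD(1)] by simp
  also have "(\<Sum>u\<in>B. if u \<in> A then 1 else 0) = real (card A)"
    using BD(4) by (simp add: sum.If_cases A_def Int_def)
  finally have le: "real (dim V) \<le> k + card A + d" .
  have "card B = card (A \<union> {b\<in>B. \<sigma> * crd B v b > 0})"
    by (rule arg_cong[where f = card]) (auto simp: A_def)
  also have "\<dots> = card A + card {b\<in>B. \<sigma> * crd B v b > 0}"
    using BD(4) by (intro card_Un_disjoint) (auto simp: A_def)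
  finally show ?thesis using le card_bases[OF B] by (auto simp: k_def split: if_splits)
qed

text \<open>The two signs in \<open>circuit_bound\<close> contribute at most \<open>d + 1\<close>
  and \<open>d\<close> coordinates. For \<open>d = 0\<close> at most one coordinate remains; it
  equals 1 by comparing heights, so \<open>v\<close> would lie in \<open>B\<close>.\<close>

lemma card_supp_vertex:
  assumes d: "codegree_bound d" and v: "v \<in> V - B"
  shows "card (supp B v) \<le> 2 * d + 1" "d \<noteq> 0"
proof -
  note BD = basesD[OF B]
  let ?p = "{b\<in>B. crd B v b > 0}" and ?n = "{b\<in>B. crd B v b < 0}"
  have p: "card ?p \<le> d + 1" and n: "card ?n \<le> d"
    using circuit_bound[OF d v, of 1] circuit_bound[OF d v, of "-1"] by simp_all
  have eq: "supp B v = ?p \<union> ?n" by (auto simp: supp_def)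
  then show "card (supp B v) \<le> 2 * d + 1"
    using card_Un_le[of ?p ?n] p n by simp
  show "d \<noteq> 0"
  proof
    assume "d = 0"
    then have "card (supp B v) \<le> 1" using card_Un_le[of ?p ?n] p n eq by simp
    moreover have "finite (supp B v)" using BD by (auto simp: supp_def)
    ultimately obtain b0 where b0: "supp B v \<subseteq> {b0}"
      by (metis card_le_Suc0_iff_eq One_nat_def empty_subsetI insertI1 subset_insertI subset_singleton_iff subsetI singletonD singletonI)
    have vs: "v \<in> span V" using v by (simp add: span_base)
    have "(\<Sum>b\<in>B. crd B v b) = 1" using h_expand[OF B vs] h_one v by simp
    moreover have z: "crd B v b = 0" if "b \<in> B" "b \<noteq> b0" for b
      using that b0 by (auto simp: supp_def)
    ultimately have b: "b0 \<in> B" using sum.neutral[of B "crd B v"] by (metis zero_neq_one)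
    have "(\<Sum>b\<in>B. crd B v b) = crd B v b0"
      using b z BD(4) by (subst sum.remove[OF BD(4) b]) simp
    moreover have "v = crd B v b0 *\<^sub>R b0"
      using expand[OF B vs] z sum.remove[OF BD(4) b, of "\<lambda>b. crd B v b *\<^sub>R b"] by simp
    ultimately have "v = b0" using \<open>(\<Sum>b\<in>B. crd B v b) = 1\<close> by simp
    then show False using b v by simp
  qed
qed

end

text \<open>The supports of box points and of points outside \<open>B\<close> together miss some
  \<open>s\<close> in \<open>B\<close>, and \<open>G\<close> is the coordinate at \<open>s\<close>.
  It vanishes on the other points of \<open>V\<close>, and it is integral on the lattice because no
  box point involves \<open>s\<close>.\<close>

theorem exists_apex:
  assumes d: "codegree_bound d" and cV: "card V \<le> c + dim V"
    and dim: "dim V \<ge> c * (2 * d + 1) + 4 * d" "dim V \<noteq> 0"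
  obtains s G where "s \<in> V" "linear G" "G s = (1::real)" "\<forall>v\<in>V - {s}. G v = 0"
    "\<forall>x\<in>L \<inter> span V. G x \<in> \<int>"
proof -
  obtain B where B: "B \<in> bases" using basis_extend[of "{}"] independent_empty by blast
  note BD = basesD[OF B]
  define D where "D = (\<Union>x\<in>unit_box B. supp B x) \<union> (\<Union>v\<in>V - B. supp B v)"
  have "card (\<Union>v\<in>V - B. supp B v) \<le> (\<Sum>v\<in>V - B. card (supp B v))"
    using finV by (intro card_UN_le) auto
  also have "\<dots> \<le> (\<Sum>v\<in>V - B. 2 * d + 1)"
    using card_supp_vertex(1)[OF B d] by (intro sum_mono)
  also have "\<dots> = card (V - B) * (2 * d + 1)" by simp
  finally have D: "card D \<le> (4 * d - 1) + card (V - B) * (2 * d + 1)"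
    using card_Un_le[of "\<Union>x\<in>unit_box B. supp B x" "\<Union>v\<in>V - B. supp B v"] card_union_supp[OF B d]
    by (simp add: D_def)
  have VB: "card (V - B) \<le> c" using cV card_bases[OF B] BD by (simp add: card_Diff_subset)
  have "card D < card B"
  proof (cases "d = 0")
    \<comment> \<open>For \<open>d = 0\<close> there are no points outside \<open>B\<close>, so
      \<open>D\<close> is empty and \<open>dim V \<noteq> 0\<close> suffices.\<close>
    case True
    then have "V - B = {}" using card_supp_vertex(2)[OF B d] by blast
    then have "card (V - B) = 0" by (simp only: card.empty)
    then have "card D \<le> 4 * d - 1" using D by simp
    then show ?thesis using True dim card_bases[OF B] by simp
  next
    case False
    have "card (V - B) * (2 * d + 1) \<le> c * (2 * d + 1)" using VB by (rule mult_right_mono) simp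
    then show ?thesis using False D dim card_bases[OF B] by linarith
  qed
  then have "\<not> B \<subseteq> D" using BD(4) card_mono[of D B] finite_subset[of D B]
    by (force simp: D_def supp_def)
  then obtain s where s: "s \<in> B" "s \<notin> D" by auto
  show thesis
  proof (rule that[of s "\<lambda>x. crd B x s"]; (intro ballI)?)
    show "s \<in> V" "linear (\<lambda>x. crd B x s)" "crd B s s = 1"
      using s BD linear_crd crd_basis[OF BD(2) s(1)] by auto
    fix v assume "v \<in> V - {s}"
    then show "crd B v s = 0"
      using s crd_basis[OF BD(2), of v s] by (cases "v \<in> B") (auto simp: D_def supp_def)
  next
    fix x assume x: "x \<in> L \<inter> span V"
    have "reduce B x \<in> unit_box B" using x by (intro reduce_box[OF B]) auto
    then have "crd B (reduce B x) s = 0" using s by (auto simp: D_def supp_def)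
    then show "crd B x s \<in> \<int>" using crd_reduce[OF B s(1)] by (simp add: frac_eq_0_iff)
  qed
qed

end

section \<open>Lattices and affine maps\<close>

text \<open>The span condition is explicit because \<open>crd\<close> is also defined outside
  \<open>span B\<close>.\<close>

definition lattice_basis :: "'a::real_vector set \<Rightarrow> 'a set \<Rightarrow> bool" where
  "lattice_basis M B \<longleftrightarrow> finite B \<and> independent B \<and> span B = span M \<and>
     (\<forall>x. x \<in> M \<longleftrightarrow> x \<in> span B \<and> (\<forall>b\<in>B. crd B x b \<in> \<int>))"

lemma z_lattice_basis:
  assumes "z_lattice M"
  obtains B where "lattice_basis M B"
proof -
  obtain B where B: "finite B" "independent B"
    "M = range (\<lambda>z. \<Sum>b\<in>B. real_of_int (z b) *\<^sub>R b)"
    using assms by (auto simp: z_lattice_def)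
  have iff: "x \<in> M \<longleftrightarrow> x \<in> span B \<and> (\<forall>b\<in>B. crd B x b \<in> \<int>)" for x
  proof
    assume "x \<in> M"
    then obtain z where "x = (\<Sum>b\<in>B. real_of_int (z b) *\<^sub>R b)" using B(3) by auto
    then show "x \<in> span B \<and> (\<forall>b\<in>B. crd B x b \<in> \<int>)"
      using crd_sum[OF B(2,1)] by (auto intro: span_sum span_scale span_base)
  next
    assume x: "x \<in> span B \<and> (\<forall>b\<in>B. crd B x b \<in> \<int>)"
    then have "x = (\<Sum>b\<in>B. real_of_int \<lfloor>crd B x b\<rfloor> *\<^sub>R b)"
      using crd_expand[OF B(2,1), of x] by simp
    then show "x \<in> M" unfolding B(3) by (rule range_eqI[where x = "\<lambda>b. \<lfloor>crd B x b\<rfloor>"])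
  qed
  have "B \<subseteq> M" using crd_basis[OF B(2)] iff span_base by fastforce
  moreover have "M \<subseteq> span B" using iff by auto
  ultimately have "span B = span M"
    by (meson span_minimal span_mono subset_antisym subspace_span)
  with B(1,2) iff have "lattice_basis M B" unfolding lattice_basis_def by blast
  then show thesis by (rule that)
qed

lemma lattice_zero: "lattice_basis M B \<Longrightarrow> 0 \<in> M"
  using linear_0[OF linear_crd, of B] by (auto simp: lattice_basis_def span_zero)

lemma lattice_diff: "lattice_basis M B \<Longrightarrow> x \<in> M \<Longrightarrow> y \<in> M \<Longrightarrow> x - y \<in> M"
  by (auto simp: lattice_basis_def span_diff crd_diff)

text \<open>Coordinates are bounded linear functionals in finite dimension, so only finitely many
  integral coordinate vectors occur on a bounded set.\<close>

lemma finite_lattice_bounded: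
  fixes M :: "'a::euclidean_space set"
  assumes B: "lattice_basis M B" and S: "bounded S"
  shows "finite (S \<inter> M)"
proof -
  have B': "finite B" "independent B" using B by (auto simp: lattice_basis_def)
  have "bounded ((\<lambda>x. crd B x b) ` S)" for b
    using S linear_crd[OF B'(2), of b] by (intro bounded_linear_image) (simp_all add: linear_conv_bounded_linear)
  then have "\<exists>N. \<forall>x\<in>S. \<bar>crd B x b\<bar> \<le> real_of_int N" for b
    by (fastforce simp: bounded_iff intro: order.trans[OF _ le_of_int_ceiling])
  then obtain N where N: "\<And>b x. x \<in> S \<Longrightarrow> \<bar>crd B x b\<bar> \<le> real_of_int (N b)" by metis
  have "S \<inter> M \<subseteq> (\<lambda>z. \<Sum>b\<in>B. real_of_int (z b) *\<^sub>R b) ` (\<Pi>\<^sub>E b\<in>B. {- N b..N b})"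
  proof
    fix x assume x: "x \<in> S \<inter> M"
    define z where "z = restrict (\<lambda>b. \<lfloor>crd B x b\<rfloor>) B"
    have z: "real_of_int (z b) = crd B x b" if "b \<in> B" for b
      using x B that by (auto simp: lattice_basis_def z_def)
    have "x = (\<Sum>b\<in>B. crd B x b *\<^sub>R b)"
      using x B crd_expand[OF B'(2,1)] by (auto simp: lattice_basis_def)
    then have "x = (\<Sum>b\<in>B. real_of_int (z b) *\<^sub>R b)" using z by simp
    moreover have "z \<in> (\<Pi>\<^sub>E b\<in>B. {- N b..N b})"
    proof (rule PiE_I)
      fix b assume b: "b \<in> B"
      have "\<bar>real_of_int (z b)\<bar> \<le> real_of_int (N b)" using N[of x b] x z[OF b] by simp
      then show "z b \<in> {- N b..N b}" by simp linarith
    qed (simp add: z_def)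
    ultimately show "x \<in> (\<lambda>z. \<Sum>b\<in>B. real_of_int (z b) *\<^sub>R b) ` (\<Pi>\<^sub>E b\<in>B. {- N b..N b})" by blast
  qed
  then show ?thesis by (rule finite_subset) (use B' in \<open>auto intro: finite_PiE\<close>)
qed

section \<open>Hulls and vertices under affine maps\<close>

context
  fixes \<phi> :: "'a::real_vector \<Rightarrow> 'b::real_vector"
  assumes aff: "\<And>x y u v. u + v = 1 \<Longrightarrow> \<phi> (u *\<^sub>R x + v *\<^sub>R y) = u *\<^sub>R \<phi> x + v *\<^sub>R \<phi> y"
begin

lemma affine_hull_affine_image: "\<phi> ` (affine hull S) = affine hull (\<phi> ` S)"
proof (rule subset_antisym)
  have "affine hull S \<subseteq> {x. \<phi> x \<in> affine hull (\<phi> ` S)}"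
  proof (rule hull_minimal)
    show "S \<subseteq> {x. \<phi> x \<in> affine hull (\<phi> ` S)}" by (auto intro: hull_inc)
    show "affine {x. \<phi> x \<in> affine hull (\<phi> ` S)}"
      using affine_affine_hull[of "\<phi> ` S"] by (simp add: affine_def aff)
  qed
  then show "\<phi> ` (affine hull S) \<subseteq> affine hull (\<phi> ` S)" by auto
  show "affine hull (\<phi> ` S) \<subseteq> \<phi> ` (affine hull S)"
  proof (rule hull_minimal)
    show "\<phi> ` S \<subseteq> \<phi> ` (affine hull S)" by (intro image_mono hull_subset)
    have "u *\<^sub>R \<phi> x + v *\<^sub>R \<phi> y \<in> \<phi> ` (affine hull S)"
      if "x \<in> affine hull S" "y \<in> affine hull S" "u + v = 1" for x y u v
      using affine_affine_hull[of S] that unfolding affine_def aff[OF that(3), symmetric] by blast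
    then show "affine (\<phi> ` (affine hull S))" by (auto simp: affine_def)
  qed
qed

lemma convex_hull_affine_image: "\<phi> ` (convex hull S) = convex hull (\<phi> ` S)"
proof (rule subset_antisym)
  have "convex hull S \<subseteq> {x. \<phi> x \<in> convex hull (\<phi> ` S)}"
  proof (rule hull_minimal)
    show "S \<subseteq> {x. \<phi> x \<in> convex hull (\<phi> ` S)}" by (auto intro: hull_inc)
    show "convex {x. \<phi> x \<in> convex hull (\<phi> ` S)}"
      using convex_convex_hull[of "\<phi> ` S"] by (simp add: convex_def aff)
  qed
  then show "\<phi> ` (convex hull S) \<subseteq> convex hull (\<phi> ` S)" by auto
  show "convex hull (\<phi> ` S) \<subseteq> \<phi> ` (convex hull S)"
  proof (rule hull_minimal)
    show "\<phi> ` S \<subseteq> \<phi> ` (convex hull S)" by (intro image_mono hull_subset)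
    have "u *\<^sub>R \<phi> x + v *\<^sub>R \<phi> y \<in> \<phi> ` (convex hull S)"
      if "x \<in> convex hull S" "y \<in> convex hull S" "u + v = 1" "u \<ge> 0" "v \<ge> 0" for x y u v
      using convex_convex_hull[of S] that unfolding convex_def aff[OF that(3), symmetric] by blast
    then show "convex (\<phi> ` (convex hull S))" by (auto simp: convex_def)
  qed
qed

text \<open>Convexity keeps all points of a segment inside \<open>P\<close>, where
  \<open>\<phi>\<close> is injective; open segments therefore correspond to open segments.\<close>

lemma vertices_affine_image:
  assumes P: "convex P" "inj_on \<phi> P"
  shows "\<phi> ` vertices P = vertices (\<phi> ` P)"
proof -
  have seg: "\<phi> x \<in> open_segment (\<phi> a) (\<phi> b) \<longleftrightarrow> x \<in> open_segment a b"
    if "x \<in> P" "a \<in> P" "b \<in> P" for x a b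
  proof -
    have "\<phi> x = (1 - u) *\<^sub>R \<phi> a + u *\<^sub>R \<phi> b \<longleftrightarrow> x = (1 - u) *\<^sub>R a + u *\<^sub>R b" if u: "0 < u" "u < 1" for u
    proof -
      have "(1 - u) *\<^sub>R a + u *\<^sub>R b \<in> P"
        using u \<open>a \<in> P\<close> \<open>b \<in> P\<close> P(1) by (intro convexD) auto
      then have "\<phi> x = \<phi> ((1 - u) *\<^sub>R a + u *\<^sub>R b) \<longleftrightarrow> x = (1 - u) *\<^sub>R a + u *\<^sub>R b"
        using P(2) \<open>x \<in> P\<close> by (auto dest: inj_onD)
      then show ?thesis by (simp add: aff)
    qed
    moreover have "\<phi> a = \<phi> b \<longleftrightarrow> a = b" using P(2) that by (auto dest: inj_onD)
    ultimately show ?thesis by (auto simp: in_segment)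
  qed
  have "\<phi> x extreme_point_of \<phi> ` P \<longleftrightarrow> x extreme_point_of P" if "x \<in> P" for x
    using that seg by (auto simp: extreme_point_of_def)
  then show ?thesis by (auto simp: vertices_def extreme_point_of_def)
qed

end

lemma finite_vertices: "polytope P \<Longrightarrow> finite (vertices P)"
  unfolding polytope_def vertices_def
  by (metis extreme_point_of_convex_hull finite_subset mem_Collect_eq subsetI)

lemma polytope_convex_hull_vertices:
  fixes P :: "'a::euclidean_space set"
  shows "polytope P \<Longrightarrow> P = convex hull (vertices P)"
  unfolding polytope_def vertices_def using Krein_Milman_polytope by metis

lemma lattice_polytope_convex_hull:
  assumes "finite S" "S \<subseteq> M"
  shows "lattice_polytope M (convex hull S)"
  unfolding lattice_polytope_def
proof (intro conjI)
  show "polytope (convex hull S)" using assms by (auto simp: polytope_def)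
  show "convex hull S \<subseteq> span M"
    using assms by (meson convex_hull_subset_span order.trans span_mono)
  show "vertices (convex hull S) \<subseteq> M"
    using assms extreme_point_of_convex_hull by (auto simp: vertices_def)
qed

section \<open>A criterion for lattice pyramids\<close>

lemma lookup_scaleR: "Poly_Mapping.lookup (r *\<^sub>R x) i = r * Poly_Mapping.lookup x i"
  for x :: "nat \<Rightarrow>\<^sub>0 real"
proof -
  have "finite {i. r * Poly_Mapping.lookup x i \<noteq> 0}"
    by (rule finite_subset[OF _ finite_keys[of x]]) (auto simp: in_keys_iff)
  then show ?thesis by (simp add: scaleR_poly_mapping_def Abs_poly_mapping_inverse)
qed

lemma in_int_lattice:
  "x \<in> int_lattice k \<longleftrightarrow> (\<forall>i\<ge>k. Poly_Mapping.lookup x i = 0) \<and> (\<forall>i<k. Poly_Mapping.lookup x i \<in> \<int>)"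
proof -
  have "Poly_Mapping.keys x \<subseteq> {..<k} \<longleftrightarrow> (\<forall>i\<ge>k. Poly_Mapping.lookup x i = 0)"
    by (metis in_keys_iff lessThan_iff not_less subset_iff)
  moreover have "Poly_Mapping.lookup x i \<in> \<int>"
    if "\<forall>i\<ge>k. Poly_Mapping.lookup x i = 0" "\<forall>i<k. Poly_Mapping.lookup x i \<in> \<int>" for i
    using that by (cases "i < k") auto
  ultimately show ?thesis by (auto simp: int_lattice_def)
qed

text \<open>The last coordinate of the isomorphism is \<open>1 - a\<close>; the apex \<open>s\<close> goes to the origin.\<close>

lemma lattice_pyramid_criterion:
  fixes M P :: "'a::euclidean_space set" and a :: "'a \<Rightarrow> real"
  assumes M: "z_lattice M" and P: "lattice_polytope M P"
    and aff: "\<And>x y u v. u + v = 1 \<Longrightarrow> a (u *\<^sub>R x + v *\<^sub>R y) = u * a x + v * a y"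
    and s: "s \<in> vertices P" "a s = 1" and zero: "\<And>v. v \<in> vertices P - {s} \<Longrightarrow> a v = 0"
    and int: "\<And>x. x \<in> affine hull P \<inter> M \<Longrightarrow> a x \<in> \<int>"
  defines "Q \<equiv> convex hull (vertices P - {s})"
  shows "lattice_polytope M Q" "aff_dim Q = aff_dim P - 1" "lattice_pyramid_over M P Q"
proof -
  let ?V = "vertices P" and ?T = "vertices P - {s}"
  have fin: "finite ?V" and PV: "P = convex hull ?V" and VM: "?V \<subseteq> M"
    using P finite_vertices polytope_convex_hull_vertices by (auto simp: lattice_polytope_def)
  have V: "?V = insert s ?T" using s by auto
  show lQ: "lattice_polytope M Q"
    unfolding Q_def using fin VM by (intro lattice_polytope_convex_hull) auto
  have a0: "a x = 0" if "x \<in> affine hull ?T" for x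
  proof -
    have "affine hull ?T \<subseteq> {x. a x = 0}"
      using zero by (intro hull_minimal) (auto simp: affine_def aff)
    then show ?thesis using that by auto
  qed
  have affP: "affine hull P = affine hull ?V" by (subst PV) (rule affine_hull_convex_hull)
  show dimQ: "aff_dim Q = aff_dim P - 1"
  proof -
    have "s \<notin> affine hull ?T" using a0 s by force
    then have "aff_dim (insert s ?T) = aff_dim Q + 1"
      by (simp only: aff_dim_insert Q_def aff_dim_convex_hull if_False)
    moreover have "aff_dim P = aff_dim (insert s ?T)"
      by (metis PV V aff_dim_convex_hull)
    ultimately show ?thesis by simp
  qed
  obtain B where B: "lattice_basis M B" using z_lattice_basis[OF M] .
  have B': "finite B" "independent B" "span B = span M" using B by (auto simp: lattice_basis_def)
  have in_M: "x \<in> M \<longleftrightarrow> (\<forall>b\<in>B. crd B x b \<in> \<int>)" if "x \<in> span M" for x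
    using B B'(3) that by (simp add: lattice_basis_def)
  \<comment> \<open>The rank of \<open>M\<close>, which may exceed the dimension of
    \<open>P\<close>; an isomorphism only compares lattice points in the affine hulls.\<close>
  define k where "k = card B"
  obtain e where e: "bij_betw e {..<k} B"
    using B'(1) by (metis ex_bij_betw_nat_finite atLeast0LessThan k_def)
  define \<psi> where "\<psi> x = (\<Sum>i<k. Poly_Mapping.single i (crd B x (e i)))" for x
  have l\<psi>: "Poly_Mapping.lookup (\<psi> x) i = (if i < k then crd B x (e i) else 0)" for x i
    by (simp add: \<psi>_def lookup_sum lookup_single when_def)
  \<comment> \<open>The shear by \<open>a x *\<^sub>R \<psi> s\<close> moves \<open>s\<close> to the
    origin and fixes the base, where \<open>a\<close> vanishes.\<close>
  define \<phi> where "\<phi> x = \<psi> x - a x *\<^sub>R \<psi> s + Poly_Mapping.single k (1 - a x)" for x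
  have l\<phi>: "Poly_Mapping.lookup (\<phi> x) i =
      (if i < k then crd B x (e i) - a x * crd B s (e i) else if i = k then 1 - a x else 0)" for x i
    by (simp add: \<phi>_def lookup_add lookup_minus lookup_scaleR l\<psi> lookup_single when_def)
  have aff\<psi>: "\<psi> (u *\<^sub>R x + v *\<^sub>R y) = u *\<^sub>R \<psi> x + v *\<^sub>R \<psi> y" for x y u v
    by (rule poly_mapping_eqI)
      (simp add: lookup_add lookup_scaleR l\<psi> crd_add[OF B'(2)] crd_scale[OF B'(2)])
  have aff\<phi>: "\<phi> (u *\<^sub>R x + v *\<^sub>R y) = u *\<^sub>R \<phi> x + v *\<^sub>R \<phi> y" if uv: "u + v = 1" for x y u v
  proof (rule poly_mapping_eqI)
    fix i
    have u: "u = 1 - v" using uv by simp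
    show "Poly_Mapping.lookup (\<phi> (u *\<^sub>R x + v *\<^sub>R y)) i = Poly_Mapping.lookup (u *\<^sub>R \<phi> x + v *\<^sub>R \<phi> y) i"
      unfolding lookup_add lookup_scaleR l\<phi> aff[OF uv] crd_add[OF B'(2)] crd_scale[OF B'(2)]
      by (simp add: u algebra_simps)
  qed
  have \<phi>s: "\<phi> s = 0" by (rule poly_mapping_eqI) (simp add: l\<phi> s)
  have \<phi>Q: "\<phi> x = \<psi> x + Poly_Mapping.single k 1" if "x \<in> Q" for x
    using a0[of x] that convex_hull_subset_affine_hull[of ?T] by (auto simp: \<phi>_def Q_def)
  have affM: "affine hull P \<subseteq> span M"
    unfolding affP using VM by (meson affine_hull_subset_span order.trans span_mono)
  have inj: "inj_on \<phi> (affine hull P)"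
  proof (rule inj_onI)
    fix x y assume x: "x \<in> affine hull P" and y: "y \<in> affine hull P" and eq: "\<phi> x = \<phi> y"
    have "a x = a y" using arg_cong[OF eq, of "\<lambda>z. Poly_Mapping.lookup z k"] by (simp add: l\<phi>)
    then have "crd B x (e i) = crd B y (e i)" if "i < k" for i
      using that arg_cong[OF eq, of "\<lambda>z. Poly_Mapping.lookup z i"] by (simp add: l\<phi>)
    then have "crd B x b = crd B y b" if "b \<in> B" for b
      using that e by (auto simp: bij_betw_def)
    moreover have "x \<in> span B" "y \<in> span B" using x y affM B'(3) by auto
    ultimately show "x = y"
      using crd_expand[OF B'(2,1), of x] crd_expand[OF B'(2,1), of y] by simp
  qed
  have eB: "(\<forall>i<k. e i \<in> B) \<and> (\<forall>b\<in>B. \<exists>i<k. b = e i)"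
    using e by (auto simp: bij_betw_def)
  have sM: "s \<in> M" using s VM by auto
  have M_int: "crd B x b \<in> \<int>" if "x \<in> M" "b \<in> B" for x b
    using that B by (auto simp: lattice_basis_def)
  have s_int: "crd B s b \<in> \<int>" if "b \<in> B" for b using M_int[OF sM that] .
  \<comment> \<open>The last coordinate determines \<open>a x\<close>, after which the others
    determine the coordinates of \<open>x\<close>. Both directions use only integer coefficients,
    since \<open>s\<close> is a lattice point.\<close>
  have lat: "\<phi> x \<in> int_lattice (k + 1) \<longleftrightarrow> x \<in> M" if x: "x \<in> affine hull P" for x
  proof
    assume xM: "x \<in> M"
    have "a x \<in> \<int>" using int x xM by auto
    then show "\<phi> x \<in> int_lattice (k + 1)"
      using xM x affM in_M[of x] s_int eB by (auto simp: in_int_lattice l\<phi>)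
  next
    assume L: "\<phi> x \<in> int_lattice (k + 1)"
    have "1 - a x \<in> \<int>" using L by (auto simp: in_int_lattice l\<phi> dest!: spec[of _ k])
    then have ax: "a x \<in> \<int>" by (metis Ints_1 Ints_diff diff_diff_eq2 add_diff_cancel_left')
    have "crd B x (e i) \<in> \<int>" if i: "i < k" for i
    proof -
      have "crd B x (e i) - a x * crd B s (e i) \<in> \<int>"
        using L i by (auto simp: in_int_lattice l\<phi> dest!: spec[of _ i])
      moreover have "a x * crd B s (e i) \<in> \<int>" using ax s_int eB i by auto
      ultimately show ?thesis using Ints_add by fastforce
    qed
    then have "\<forall>b\<in>B. crd B x b \<in> \<int>" using eB by metis
    then show "x \<in> M" using in_M[of x] x affM by auto
  qed
  define B0 where "B0 = \<psi> ` Q"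
  have B0: "B0 = convex hull (\<psi> ` ?T)"
    unfolding B0_def Q_def by (rule convex_hull_affine_image) (rule aff\<psi>)
  have lB0: "lattice_polytope (int_lattice k) B0"
    unfolding B0
  proof (rule lattice_polytope_convex_hull)
    show "\<psi> ` ?T \<subseteq> int_lattice k"
      using VM M_int eB by (auto simp: in_int_lattice l\<psi>)
  qed (use fin in auto)
  have lift: "lift1 k B0 = \<phi> ` Q" 
    unfolding lift1_def B0_def image_image using \<phi>Q by (intro image_cong) auto
  have pyr: "std_pyramid k 1 B0 = \<phi> ` P"
  proof -
    have "std_pyramid k 1 B0 = convex hull (\<phi> ` insert s Q)"
      by (simp add: lift \<phi>s)
    also have "\<dots> = \<phi> ` (convex hull (insert s Q))"
      by (rule convex_hull_affine_image[symmetric]) (rule aff\<phi>)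
    also have "convex hull (insert s Q) = P"
      unfolding Q_def by (metis PV V hull_insert)
    finally show ?thesis .
  qed
  have PH: "P \<subseteq> affine hull P" by (rule hull_subset)
  have iso: "lattice_polytope_iso M P (int_lattice (k + 1)) (std_pyramid k 1 B0) \<phi>"
    unfolding lattice_polytope_iso_def
  proof (intro conjI)
    show "affine_map_on (affine hull P) \<phi>"
      by (simp add: affine_map_on_def aff\<phi>)
    have aH: "affine hull (std_pyramid k 1 B0) = \<phi> ` (affine hull P)"
      unfolding pyr by (rule affine_hull_affine_image[symmetric]) (rule aff\<phi>)
    show "bij_betw \<phi> (affine hull P \<inter> M) (affine hull std_pyramid k 1 B0 \<inter> int_lattice (k + 1))"
      unfolding bij_betw_def aH using inj lat by (auto intro: inj_on_subset)
    show "\<phi> ` vertices P = vertices (std_pyramid k 1 B0)"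
      unfolding pyr
    proof (rule vertices_affine_image)
      show "convex P" by (subst PV) (rule convex_convex_hull)
      show "inj_on \<phi> P" using inj PH by (rule inj_on_subset)
    qed (rule aff\<phi>)
  qed
  have "Q \<subseteq> P" unfolding Q_def by (subst PV) (intro hull_mono, auto)
  moreover have "nat (aff_dim P - aff_dim Q) = 1" using dimQ by simp
  moreover have "\<phi> ` Q = std_base k 1 B0" by (simp add: lift)
  ultimately show "lattice_pyramid_over M P Q"
    unfolding lattice_pyramid_over_def Let_def using P lQ lB0 iso by metis
qed

section \<open>Homogenisation\<close>

abbreviation lift_one :: "'a::real_vector \<Rightarrow> 'a \<times> real" where
  "lift_one v \<equiv> (v, 1)"

lemma sum_lift_one: "(\<Sum>v\<in>S. (c v *\<^sub>R v, c v)) = (\<Sum>v\<in>S. c v *\<^sub>R v, \<Sum>v\<in>S. c v)"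
  by (induction S rule: infinite_finite_induct) (auto simp: zero_prod_def)

lemma inj_lift_one: "inj_on lift_one S"
  by (auto simp: inj_on_def)

lemma lift_one_affine_hull:
  assumes "finite S" "x \<in> affine hull S"
  shows "lift_one x \<in> span (lift_one ` S)"
proof -
  obtain u where u: "sum u S = 1" "(\<Sum>v\<in>S. u v *\<^sub>R v) = x"
    using assms by (auto simp: affine_hull_finite)
  then have "lift_one x = (\<Sum>v\<in>S. u v *\<^sub>R lift_one v)" by (simp add: sum_lift_one)
  also have "\<dots> \<in> span (lift_one ` S)" by (intro span_sum span_scale span_base imageI)
  finally show ?thesis .
qed

text \<open>The extra coordinate records the sum of the coefficients, so linear dependencies among
  lifted points are exactly affine dependencies. An affine basis thus lifts to a linear one.\<close>

lemma dim_lift_one: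
  fixes S :: "'a::euclidean_space set"
  assumes "finite S"
  shows "int (dim (lift_one ` S)) = aff_dim S + 1"
proof -
  obtain T where T: "T \<subseteq> S" "\<not> affine_dependent T" "affine hull S = affine hull T"
    using affine_basis_exists[of S] by auto
  have finT: "finite T" using T(1) assms finite_subset by auto
  have "independent (lift_one ` T)"
  proof
    assume "dependent (lift_one ` T)"
    then obtain u v where u: "v \<in> T" "u (lift_one v) \<noteq> 0" "(\<Sum>x\<in>lift_one ` T. u x *\<^sub>R x) = 0"
      using finT by (auto simp: dependent_finite)
    from u(3) have "(\<Sum>v\<in>T. u (lift_one v) *\<^sub>R lift_one v) = 0"
      by (simp add: sum.reindex[OF inj_lift_one] o_def)
    then have "(\<Sum>v\<in>T. u (lift_one v) *\<^sub>R v) = 0" "(\<Sum>v\<in>T. u (lift_one v)) = 0"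
      by (simp_all add: sum_lift_one zero_prod_def)
    then have "affine_dependent T"
      unfolding affine_dependent_explicit_finite[OF finT] using u by (intro exI[of _ "\<lambda>v. u (lift_one v)"]) auto
    then show False using T by simp
  qed
  moreover have "lift_one ` S \<subseteq> span (lift_one ` T)"
  proof
    fix y assume "y \<in> lift_one ` S"
    then obtain x where "x \<in> S" "y = lift_one x" by auto
    then show "y \<in> span (lift_one ` T)"
      using lift_one_affine_hull[OF finT, of x] T(3) hull_inc[of x S] by auto
  qed
  then have "span (lift_one ` S) = span (lift_one ` T)"
    using T(1) by (intro subset_antisym span_minimal span_mono) auto
  ultimately have "dim (lift_one ` S) = card (lift_one ` T)"
    by (metis dim_eq_card)
  also have "\<dots> = card T" by (rule card_image[OF inj_lift_one])
  finally show ?thesis using aff_dim_unique[of T S] T by simp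
qed

theorem theorem1p7:
  fixes c d n :: nat
    and M P :: "'a::euclidean_space set"
  assumes "z_lattice M"
    and "lattice_polytope M P"
    and "aff_dim P = int n"
    and "card (vertices P) \<le> c + n + 1"
    and "polytope_degree M P \<le> d"
    and "int n \<ge> int c * (2 * int d + 1) + 4 * int d - 1"
  shows "\<exists>Q. lattice_polytope M Q \<and> aff_dim Q = int n - 1 \<and> lattice_pyramid_over M P Q"
proof -
  let ?W = "vertices P"
  have fin: "finite ?W" and PW: "P = convex hull ?W" and WM: "?W \<subseteq> M" and poly: "polytope P"
    using assms(2) finite_vertices polytope_convex_hull_vertices by (auto simp: lattice_polytope_def)
  have ne: "P \<noteq> {}" using assms(3) by auto
  obtain B where B: "lattice_basis M B" using z_lattice_basis[OF assms(1)] .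
  define V where "V = lift_one ` ?W"
  interpret height_config V snd
    by unfold_locales (use fin in \<open>auto simp: V_def linear_snd\<close>)
  have level: "(x, real k) \<in> pos_cone \<longleftrightarrow> x \<in> (*\<^sub>R) (real k) ` P" for x k
  proof
    assume "(x, real k) \<in> pos_cone"
    then obtain b where "\<forall>v\<in>V. b v \<ge> 0" "(x, real k) = (\<Sum>v\<in>V. b v *\<^sub>R v)"
      by (auto simp: pos_cone_def)
    then have b: "\<forall>v\<in>?W. b (lift_one v) \<ge> 0" "(x, real k) = (\<Sum>v\<in>?W. b (lift_one v) *\<^sub>R lift_one v)"
      by (auto simp: V_def sum.reindex[OF inj_lift_one])
    define u where "u v = b (lift_one v)" for v
    have u: "\<forall>v\<in>?W. u v \<ge> 0" "x = (\<Sum>v\<in>?W. u v *\<^sub>R v)" "real k = (\<Sum>v\<in>?W. u v)"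
      using b by (auto simp: u_def sum_lift_one)
    show "x \<in> (*\<^sub>R) (real k) ` P"
    \<comment> \<open>Division by \<open>k\<close> fails at height 0; there the coefficients are
      non-negative with sum 0, so \<open>x = 0\<close>.\<close>
    proof (cases "k = 0")
      case True
      then have "\<forall>v\<in>?W. u v = 0" using u fin by (simp add: sum_nonneg_eq_0_iff)
      then have "x = 0" using u by simp
      then show ?thesis using True ne by auto
    next
      case False
      have "(\<Sum>v\<in>?W. (u v / real k) *\<^sub>R v) \<in> P"
        using u False fin
        by (subst PW) (auto simp: convex_hull_finite simp flip: sum_divide_distrib
            intro!: exI[of _ "\<lambda>v. u v / real k"])
      moreover have "x = real k *\<^sub>R (\<Sum>v\<in>?W. (u v / real k) *\<^sub>R v)"
        using u(2) False by (simp add: scaleR_sum_right)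
      ultimately show ?thesis by blast
    qed
  next
    assume "x \<in> (*\<^sub>R) (real k) ` P"
    then obtain y where y: "y \<in> P" "x = real k *\<^sub>R y" by auto
    then obtain u where u: "\<forall>v\<in>?W. u v \<ge> 0" "sum u ?W = 1" "y = (\<Sum>v\<in>?W. u v *\<^sub>R v)"
      by (subst (asm) PW) (auto simp: convex_hull_finite[OF fin])
    have "(x, real k) = (\<Sum>v\<in>V. (real k * u (fst v)) *\<^sub>R v)"
      by (simp add: V_def sum.reindex[OF inj_lift_one] o_def sum_lift_one y(2) u(3) scaleR_sum_right
          u(2) flip: sum_distrib_left)
    moreover have "real k * u (fst v) \<ge> 0" if "v \<in> V" for v
      using that u(1) by (auto simp: V_def)
    ultimately show "(x, real k) \<in> pos_cone" by (simp only: comb_in_cone[OF order.refl])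
  qed
  \<comment> \<open>The integral second factor makes all heights integers.\<close>
  let ?L = "M \<times> \<int>"
  have lev: "{x \<in> ?L \<inter> pos_cone. snd x = real k} = (\<lambda>m. (m, real k)) ` ((*\<^sub>R) (real k) ` P \<inter> M)" for k
    using level by (auto simp del: image_iff)
  interpret lattice_config V snd ?L
  proof unfold_locales
    show "finite {x \<in> ?L \<inter> pos_cone. snd x = real k}" for k
      unfolding lev using polytope_imp_bounded[OF poly]
      by (intro finite_imageI finite_lattice_bounded[OF B] bounded_scaling)
  qed (use WM lattice_zero[OF B] lattice_diff[OF B] in \<open>auto simp: V_def zero_prod_def\<close>)
  have aW: "aff_dim ?W = int n" using assms(3) aff_dim_convex_hull[of ?W] PW by metis
  have dimV: "dim V = n + 1" using dim_lift_one[OF fin] aW by (simp add: V_def)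
  have series: "series = ehrhart_series M P"
  proof (rule fps_ext)
    fix k
    have "card {x \<in> ?L \<inter> pos_cone. snd x = real k} = card ((*\<^sub>R) (real k) ` P \<inter> M)"
      unfolding lev by (rule card_image) (auto simp: inj_on_def)
    \<comment> \<open>The series prescribes the constant term 1; the count agrees with it because
      \<open>P\<close> is non-empty.\<close>
    moreover have "card ((*\<^sub>R) (real 0) ` P \<inter> M) = 1"
    proof -
      have "(*\<^sub>R) (real 0) ` P \<inter> M = {0}" using ne lattice_zero[OF B] by auto
      then show ?thesis by simp
    qed
    ultimately show "fps_nth series k = fps_nth (ehrhart_series M P) k"
      by (simp add: series_def ehrhart_series_def)
  qed
  obtain p where "fps_of_poly p = series * (1 - fps_X) ^ dim V" and bound: "codegree_bound (degree p)"
    by (rule series_poly)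
  then have p: "fps_of_poly p = ehrhart_series M P * (1 - fps_X) ^ (n + 1)"
    by (simp only: series dimV)
  have e: "nat (aff_dim P + 1) = n + 1" using assms(3) by simp
  \<comment> \<open>The definite description is resolved by the injectivity of
    \<open>fps_of_poly\<close>.\<close>
  have "hstar_poly M P = p"
    unfolding hstar_poly_def e p[symmetric] fps_of_poly_eq_iff by simp
  then have "degree p \<le> d" using assms(5) by (simp add: polytope_degree_def)
  with bound have "codegree_bound d" by (rule codegree_bound_mono)
  moreover have "card V \<le> c + dim V"
    using assms(4) dimV card_image[OF inj_lift_one, of ?W] by (simp add: V_def)
  \<comment> \<open>The passage from \<open>n\<close> to \<open>dim V = n + 1\<close> absorbs the -1
    of the hypothesis. The integers avoid truncated subtraction.\<close>
  moreover have "dim V \<ge> c * (2 * d + 1) + 4 * d"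
  proof -
    have "int (c * (2 * d + 1) + 4 * d) \<le> int (n + 1)"
      using assms(6) by (simp add: algebra_simps)
    then show ?thesis unfolding dimV by (rule of_nat_le_iff[THEN iffD1])
  qed
  moreover have "dim V \<noteq> 0" using dimV by simp
  ultimately obtain s' G where G: "s' \<in> V" "linear G" "G s' = (1::real)"
    "\<forall>v\<in>V - {s'}. G v = 0" "\<forall>x\<in>?L \<inter> span V. G x \<in> \<int>"
    by (rule exists_apex)
  obtain s where s: "s \<in> ?W" "s' = lift_one s" using G(1) by (auto simp: V_def)
  \<comment> \<open>Restricting \<open>G\<close> to height 1 turns the linear functional into the
    affine function required by the pyramid criterion.\<close>
  define a where "a x = G (lift_one x)" for x
  have aff: "a (u *\<^sub>R x + v *\<^sub>R y) = u * a x + v * a y" if uv: "u + v = 1" for x y u v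
  proof -
    have "lift_one (u *\<^sub>R x + v *\<^sub>R y) = u *\<^sub>R lift_one x + v *\<^sub>R lift_one y" using uv by simp
    then show ?thesis
      unfolding a_def by (simp only: linear_add[OF G(2)] linear_scale[OF G(2)] real_scaleR_def)
  qed
  have "a x \<in> \<int>" if x: "x \<in> affine hull P \<inter> M" for x
  proof -
    have "x \<in> affine hull ?W" using x PW affine_hull_convex_hull by (metis IntD1)
    then show ?thesis using lift_one_affine_hull[OF fin, of x] x G(5) by (auto simp: a_def V_def)
  qed
  moreover have "a s = 1" "\<And>v. v \<in> ?W - {s} \<Longrightarrow> a v = 0"
    using G s by (auto simp: a_def V_def)
  ultimately show ?thesis
    using lattice_pyramid_criterion[OF assms(1,2) aff s(1)] assms(3) by metis
qed

end
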